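(* Let $\Gamma=\Lambda\rtimes F$ be a semi-direct product, where $\Lambda$ is identified with $\mathbb{Z}^m$, $m\ge1$, and $F$ is a finite group. Let $\mu$ be a probability measure on $\Gamma$ with finite second moment such that the support of $\mu$ generates $\Gamma$ as a semigroup. Let $\rho\in[0,1]$ and let $\pi^\rho=\rho(\mu\times\mu)+(1-\rho)\mu_{\mathrm{diag}}$ on $\Gamma\times\Gamma$; assume that $\pi^\rho$ is aperiodic and its support generates $\Gamma\times\Gamma$ as a semigroup. Then, in a basis adapted to the decomposition $\mathbb{R}^m\times\mathbb{R}^m=\operatorname{im}(\underline\vartheta)\oplus\operatorname{im}(\underline\vartheta)^\perp\oplus\operatorname{im}(\underline\vartheta)\oplus\operatorname{im}(\underline\vartheta)^\perp$, $$\Sigma_{\pi^\rho}=\begin{pmatrix} \Sigma_\mu & A \\ A & \Sigma_\mu \end{pmatrix},\qquad A=\begin{pmatrix} (1-\rho)\,\Sigma_\mu|_{\operatorname{im}(\underline\vartheta)\times\operatorname{im}(\underline\vartheta)} & 0 \\ 0 & 0 \end{pmatrix}.$$ That is: for all $v,w\in\mathbb{R}^m$, $\langle(v,0),\Sigma_{\pi^\rho}(w,0)\rangle=\langle(0,v),\Sigma_{\pi^\rho}(0,w)\rangle=\langle v,\Sigma_\mu w\rangle$; $\langle(v,0),\Sigma_{\pi^\rho}(0,w)\rangle=(1-\rho)\langle v,\Sigma_\mu w\rangle$ if $v,w\in\operatorname{im}(\underline\vartheta)$; and $\langle(v,0),\Sigma_{\pi^\rho}(0,w)\rangle=0$ if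 $v\in\operatorname{im}(\underline\vartheta)^\perp$ or $w\in\operatorname{im}(\underline\vartheta)^\perp$.
   Context: $\mu_{\mathrm{diag}}((\gamma,\gamma'))=\mu(\gamma)$ if $\gamma=\gamma'$ and $0$ otherwise. A probability measure $\nu$ on a group is aperiodic if $\gcd\{n\ge1:\nu^{*n}(\mathrm{id})>0\}=1$; it has finite second moment if $\sum_g|g|^2\nu(g)<\infty$ for a word metric. Inner product and normalized transfer. Conjugation gives an action $\mathrm{Ad}$ of $F=\Lambda\backslash\Gamma$ on $\Lambda=\mathbb{Z}^m$, $\mathrm{Ad}(\Lambda x)\lambda=x\lambda x^{-1}$, extended linearly to $\mathbb{R}^m$. Fix an inner product $\langle\cdot,\cdot\rangle$ on $\mathbb{R}^m$ invariant under $\mathrm{Ad}(F)$, and use the induced product inner product $\langle(v_1,v_2),(w_1,w_2)\rangle=\langle v_1,w_1\rangle+\langle v_2,w_2\rangle$ on $\mathbb{R}^m\times\mathbb{R}^m$; these inner products are used in all definitions below, including orthogonal complements. Put $\underline\vartheta(v)=\frac1{\#F}\sum_{f\in F}\mathrm{Ad}(f)v$, $v\in\mathbb{R}^m$. Covariance. Let $\Gamma$ be an infinite finitely generated group, $\Lambda$ a finite-index normal subgroup identified with a lattice $\mathbb{Z}^k$ in the inner product space $\mathbb{R}^k$, $\Delta\ni\mathrm{id}$ a set of representatives with $\Gamma=\bigsqcup_{x\in\Delta}\Lambda x$, and $\nu$ a probability measure with finite second moment whose support $S$ generates $\Gamma$ as a semigroup. Let $V(G)=\Lambda\backslash\Gamma$,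 $[\gamma]=\Lambda\gamma$, $E(G)=\{([\gamma],s):s\in S\cup S^{-1}\}$, and for $e=([\gamma],s)$: $oe=[\gamma]$, $te=[\gamma s]$, $\bar e=([\gamma s],s^{-1})$; let $\pi$ be uniform on $V(G)$ and $c(e)=\pi(oe)\nu(s)$. A $1$-form is $\omega:E(G)\to\mathbb{R}$ with $\omega(\bar e)=-\omega(e)$; $\ell_c^2(G,\mathbb{R})$ consists of those with $\sum_e\omega(e)^2c(e)<\infty$. $df(e)=f(te)-f(oe)$ for $f:V(G)\to\mathbb{R}$; $d^*\omega(x)=-\frac1{\pi(x)}\sum_{e:oe=x}c(e)\omega(e)$; $\chi_c(\omega)=\sum_e\omega(e)c(e)$; $\omega$ is harmonic if $d^*\omega+\chi_c(\omega)=0$. Each $\omega\in\ell^2_c(G,\mathbb{R})$ is $u+df$ for a unique harmonic $u$ (its harmonic part). $\Phi(vx)=v$ for $v\in\Lambda$, $x\in\Delta$; $\Phi_e=\Phi(\gamma s)-\Phi(\gamma)$; $\widehat v(e)=\langle v,\Phi_e\rangle$. Then $\Sigma_\nu$ is defined by $\langle v_1,\Sigma_\nu v_2\rangle=\sum_eu_1(e)u_2(e)c(e)-\sum_eu_1(e)c(e)\sum_eu_2(e)c(e)$, with $u_i$ the harmonic part of $\widehat v_i$. $\Sigma_\mu$ is this for $(\Gamma,\Lambda,\mu)$ with representatives $\Delta$, and $\Sigma_{\pi^\rho}$ is this for $(\Gamma\times\Gamma,\Lambda\times\Lambda,\pi^\rho)$ with representatives $\Delta\times\Delta$. *)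

theory Defs
  imports "HOL-Probability.Probability" "HOL-Algebra.Algebra"
begin

section \<open>Probability measures on groups\<close>

text \<open>A probability measure on a countable group \<open>G\<close> is a pmf whose support lies in
  \<open>carrier G\<close>.\<close>

inductive_set semigroup_generated :: "('g, 'r) monoid_scheme \<Rightarrow> 'g set \<Rightarrow> 'g set"
  for G :: "('g, 'r) monoid_scheme" and S :: "'g set" where
  base: "s \<in> S \<Longrightarrow> s \<in> semigroup_generated G S"
| mult: "x \<in> semigroup_generated G S \<Longrightarrow> y \<in> semigroup_generated G S
          \<Longrightarrow> x \<otimes>\<^bsub>G\<^esub> y \<in> semigroup_generated G S"

definition inverses :: "('g, 'r) monoid_scheme \<Rightarrow> 'g set \<Rightarrow> 'g set" where
  "inverses G S = (\<lambda>s. inv\<^bsub>G\<^esub> s) ` S"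

definition word_length :: "('g, 'r) monoid_scheme \<Rightarrow> 'g set \<Rightarrow> 'g \<Rightarrow> nat" where
  "word_length G S g = (LEAST n. \<exists>ws. length ws = n \<and> set ws \<subseteq> S \<union> inverses G S \<and>
     foldr (\<otimes>\<^bsub>G\<^esub>) ws \<one>\<^bsub>G\<^esub> = g)"

definition finite_second_moment :: "('g, 'r) monoid_scheme \<Rightarrow> 'g pmf \<Rightarrow> bool" where
  "finite_second_moment G \<nu> \<longleftrightarrow>
     (\<exists>S. finite S \<and> S \<subseteq> carrier G \<and> generate G S = carrier G \<and>
       (\<lambda>g. (real (word_length G S g))\<^sup>2 * pmf \<nu> g) summable_on carrier G)"

primrec convolution_power :: "('g, 'r) monoid_scheme \<Rightarrow> 'g pmf \<Rightarrow> nat \<Rightarrow> 'g pmf" where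
  "convolution_power G \<nu> 0 = return_pmf \<one>\<^bsub>G\<^esub>"
| "convolution_power G \<nu> (Suc n) =
     map_pmf (\<lambda>(x, y). x \<otimes>\<^bsub>G\<^esub> y) (pair_pmf (convolution_power G \<nu> n) \<nu>)"

definition aperiodic :: "('g, 'r) monoid_scheme \<Rightarrow> 'g pmf \<Rightarrow> bool" where
  "aperiodic G \<nu> \<longleftrightarrow> Gcd {n. n \<ge> 1 \<and> pmf (convolution_power G \<nu> n) \<one>\<^bsub>G\<^esub> > 0} = 1"

definition diag_pmf :: "'g pmf \<Rightarrow> ('g \<times> 'g) pmf" where
  "diag_pmf \<mu> = map_pmf (\<lambda>\<gamma>. (\<gamma>, \<gamma>)) \<mu>"

text \<open>\<open>\<pi>\<^sup>\<rho>\<close>; \<open>pmf_pi_rho\<close> below gives its mass function for \<open>\<rho> \<in> [0, 1]\<close>.\<close>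

definition pi_rho :: "real \<Rightarrow> 'g pmf \<Rightarrow> ('g \<times> 'g) pmf" where
  "pi_rho \<rho> \<mu> =
     bind_pmf (bernoulli_pmf \<rho>) (\<lambda>b. if b then pair_pmf \<mu> \<mu> else diag_pmf \<mu>)"

lemma pmf_diag_pmf: "pmf (diag_pmf \<mu>) (\<gamma>, \<gamma>') = (if \<gamma> = \<gamma>' then pmf \<mu> \<gamma> else 0)"
proof (cases "\<gamma> = \<gamma>'")
  case True
  have "inj (\<lambda>\<gamma>::'a. (\<gamma>, \<gamma>))" by (simp add: inj_def)
  then show ?thesis using True unfolding diag_pmf_def
    by (metis (mono_tags, lifting) pmf_map_inj')
next
  case False
  then have "(\<gamma>, \<gamma>') \<notin> set_pmf (diag_pmf \<mu>)" by (auto simp: diag_pmf_def)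
  then show ?thesis using False by (simp add: set_pmf_iff)
qed

lemma pmf_pi_rho:
  assumes "0 \<le> \<rho>" "\<rho> \<le> 1"
  shows "pmf (pi_rho \<rho> \<mu>) (\<gamma>, \<gamma>') =
    \<rho> * (pmf \<mu> \<gamma> * pmf \<mu> \<gamma>') + (1 - \<rho>) * (if \<gamma> = \<gamma>' then pmf \<mu> \<gamma> else 0)"
  using assms by (simp add: pi_rho_def pmf_bind pmf_pair pmf_diag_pmf)

section \<open>Lattice subgroups, inner products and the normalized transfer\<close>

definition is_inner_product :: "('v::real_vector \<Rightarrow> 'v \<Rightarrow> real) \<Rightarrow> bool" where
  "is_inner_product ip \<longleftrightarrow>
     (\<forall>v. linear (ip v)) \<and> (\<forall>w. linear (\<lambda>v. ip v w)) \<and>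
     (\<forall>v w. ip v w = ip w v) \<and> (\<forall>v. v \<noteq> 0 \<longrightarrow> ip v v > 0)"

definition prod_inner ::
  "('v \<Rightarrow> 'v \<Rightarrow> real) \<Rightarrow> 'v \<times> 'v \<Rightarrow> 'v \<times> 'v \<Rightarrow> real" where
  "prod_inner ip v w = ip (fst v) (fst w) + ip (snd v) (snd w)"

definition orth_compl :: "('v \<Rightarrow> 'v \<Rightarrow> real) \<Rightarrow> 'v set \<Rightarrow> 'v set" where
  "orth_compl ip W = {v. \<forall>w\<in>W. ip v w = 0}"

text \<open>The identification of a subgroup \<open>\<Lambda>\<close> with \<open>\<int>\<^sup>m \<subseteq> \<real>\<^sup>m\<close> is a map \<open>\<iota>\<close>, only used on \<open>\<Lambda>\<close>.\<close>

definition identifies_with_Zm ::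
  "('g, 'r) monoid_scheme \<Rightarrow> 'g set \<Rightarrow> ('g \<Rightarrow> real ^ 'm) \<Rightarrow> bool" where
  "identifies_with_Zm G \<Lambda> \<iota> \<longleftrightarrow>
     (\<forall>x\<in>\<Lambda>. \<forall>y\<in>\<Lambda>. \<iota> (x \<otimes>\<^bsub>G\<^esub> y) = \<iota> x + \<iota> y) \<and>
     bij_betw \<iota> \<Lambda> {v. \<forall>i. v $ i \<in> \<int>}"

definition semidirect_product :: "('g, 'r) monoid_scheme \<Rightarrow> 'g set \<Rightarrow> 'g set \<Rightarrow> bool" where
  "semidirect_product G N H \<longleftrightarrow>
     group G \<and> N \<lhd> G \<and> subgroup H G \<and> N \<inter> H = {\<one>\<^bsub>G\<^esub>} \<and> N <#>\<^bsub>G\<^esub> H = carrier G"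

text \<open>The action of \<open>\<Lambda>\<setminus>\<Gamma>\<close>, whose elements are the right cosets \<open>C = \<Lambda>x\<close>,
  by linear extension of conjugation on \<open>\<Lambda>\<close>. It does not depend on the representative
  \<open>x \<in> C\<close>, since \<open>\<Lambda>\<close> is abelian.\<close>

definition Ad ::
  "('g, 'r) monoid_scheme \<Rightarrow> 'g set \<Rightarrow> ('g \<Rightarrow> 'v::real_vector) \<Rightarrow> 'g set \<Rightarrow> 'v \<Rightarrow> 'v" where
  "Ad G \<Lambda> \<iota> C = (THE T. linear T \<and>
     (\<forall>x\<in>C. \<forall>l\<in>\<Lambda>. T (\<iota> l) = \<iota> (x \<otimes>\<^bsub>G\<^esub> l \<otimes>\<^bsub>G\<^esub> inv\<^bsub>G\<^esub> x)))"

definition Ad_invariant ::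
  "('g, 'r) monoid_scheme \<Rightarrow> 'g set \<Rightarrow> ('g \<Rightarrow> 'v::real_vector) \<Rightarrow> ('v \<Rightarrow> 'v \<Rightarrow> real) \<Rightarrow> bool"
  where
  "Ad_invariant G \<Lambda> \<iota> ip \<longleftrightarrow>
     (\<forall>C \<in> rcosets\<^bsub>G\<^esub> \<Lambda>. \<forall>v w. ip (Ad G \<Lambda> \<iota> C v) (Ad G \<Lambda> \<iota> C w) = ip v w)"

definition normalized_transfer ::
  "('g, 'r) monoid_scheme \<Rightarrow> 'g set \<Rightarrow> ('g \<Rightarrow> 'v::real_vector) \<Rightarrow> 'v \<Rightarrow> 'v" where
  "normalized_transfer G \<Lambda> \<iota> v =
     (1 / real (card (rcosets\<^bsub>G\<^esub> \<Lambda>))) *\<^sub>R (\<Sum>C \<in> rcosets\<^bsub>G\<^esub> \<Lambda>. Ad G \<Lambda> \<iota> C v)"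

definition representatives :: "('g, 'r) monoid_scheme \<Rightarrow> 'g set \<Rightarrow> 'g set \<Rightarrow> bool" where
  "representatives G \<Lambda> \<Delta> \<longleftrightarrow> \<Delta> \<subseteq> carrier G \<and> \<one>\<^bsub>G\<^esub> \<in> \<Delta> \<and>
     (\<forall>\<gamma>\<in>carrier G. \<exists>!x. x \<in> \<Delta> \<and> \<gamma> \<in> \<Lambda> #>\<^bsub>G\<^esub> x)"

section \<open>The weighted quotient graph and its 1-forms\<close>

text \<open>An edge is a pair \<open>(\<Lambda>\<gamma>, s)\<close>; its end point \<open>\<Lambda>\<gamma>s\<close> is the translate by \<open>s\<close>
  of the coset \<open>\<Lambda>\<gamma>\<close>.\<close>

type_synonym 'g edge = "'g set \<times> 'g"

definition edges :: "('g, 'r) monoid_scheme \<Rightarrow> 'g set \<Rightarrow> 'g pmf \<Rightarrow> 'g edge set" where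
  "edges G \<Lambda> \<nu> = (rcosets\<^bsub>G\<^esub> \<Lambda>) \<times> (set_pmf \<nu> \<union> inverses G (set_pmf \<nu>))"

definition edge_start :: "'g edge \<Rightarrow> 'g set" where
  "edge_start e = fst e"

definition edge_end :: "('g, 'r) monoid_scheme \<Rightarrow> 'g edge \<Rightarrow> 'g set" where
  "edge_end G e = fst e #>\<^bsub>G\<^esub> snd e"

definition edge_rev :: "('g, 'r) monoid_scheme \<Rightarrow> 'g edge \<Rightarrow> 'g edge" where
  "edge_rev G e = (fst e #>\<^bsub>G\<^esub> snd e, inv\<^bsub>G\<^esub> (snd e))"

definition vertex_weight :: "('g, 'r) monoid_scheme \<Rightarrow> 'g set \<Rightarrow> 'g set \<Rightarrow> real" where
  "vertex_weight G \<Lambda> x = 1 / real (card (rcosets\<^bsub>G\<^esub> \<Lambda>))"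

definition edge_weight :: "('g, 'r) monoid_scheme \<Rightarrow> 'g set \<Rightarrow> 'g pmf \<Rightarrow> 'g edge \<Rightarrow> real" where
  "edge_weight G \<Lambda> \<nu> e = vertex_weight G \<Lambda> (edge_start e) * pmf \<nu> (snd e)"

text \<open>Functions on the edge set are extensional, so that they are determined by their values
  on edges and the harmonic part below is unique as a HOL function.\<close>

definition one_forms :: "('g, 'r) monoid_scheme \<Rightarrow> 'g set \<Rightarrow> 'g pmf \<Rightarrow> ('g edge \<Rightarrow> real) set" where
  "one_forms G \<Lambda> \<nu> =
     {\<omega> \<in> extensional (edges G \<Lambda> \<nu>). \<forall>e \<in> edges G \<Lambda> \<nu>. \<omega> (edge_rev G e) = - \<omega> e}"

definition ell2_forms :: "('g, 'r) monoid_scheme \<Rightarrow> 'g set \<Rightarrow> 'g pmf \<Rightarrow> ('g edge \<Rightarrow> real) set" where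
  "ell2_forms G \<Lambda> \<nu> =
     {\<omega> \<in> one_forms G \<Lambda> \<nu>. (\<lambda>e. (\<omega> e)\<^sup>2 * edge_weight G \<Lambda> \<nu> e) summable_on edges G \<Lambda> \<nu>}"

definition differential ::
  "('g, 'r) monoid_scheme \<Rightarrow> 'g set \<Rightarrow> 'g pmf \<Rightarrow> ('g set \<Rightarrow> real) \<Rightarrow> 'g edge \<Rightarrow> real" where
  "differential G \<Lambda> \<nu> f = (\<lambda>e \<in> edges G \<Lambda> \<nu>. f (edge_end G e) - f (edge_start e))"

definition codifferential ::
  "('g, 'r) monoid_scheme \<Rightarrow> 'g set \<Rightarrow> 'g pmf \<Rightarrow> ('g edge \<Rightarrow> real) \<Rightarrow> 'g set \<Rightarrow> real" where
  "codifferential G \<Lambda> \<nu> \<omega> x = - (1 / vertex_weight G \<Lambda> x) *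
     (\<Sum>\<^sub>\<infinity>e \<in> {e \<in> edges G \<Lambda> \<nu>. edge_start e = x}. edge_weight G \<Lambda> \<nu> e * \<omega> e)"

definition chi :: "('g, 'r) monoid_scheme \<Rightarrow> 'g set \<Rightarrow> 'g pmf \<Rightarrow> ('g edge \<Rightarrow> real) \<Rightarrow> real" where
  "chi G \<Lambda> \<nu> \<omega> = (\<Sum>\<^sub>\<infinity>e \<in> edges G \<Lambda> \<nu>. \<omega> e * edge_weight G \<Lambda> \<nu> e)"

definition harmonic ::
  "('g, 'r) monoid_scheme \<Rightarrow> 'g set \<Rightarrow> 'g pmf \<Rightarrow> ('g edge \<Rightarrow> real) \<Rightarrow> bool" where
  "harmonic G \<Lambda> \<nu> \<omega> \<longleftrightarrow>
     (\<forall>x \<in> rcosets\<^bsub>G\<^esub> \<Lambda>. codifferential G \<Lambda> \<nu> \<omega> x + chi G \<Lambda> \<nu> \<omega> = 0)"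

definition harmonic_part ::
  "('g, 'r) monoid_scheme \<Rightarrow> 'g set \<Rightarrow> 'g pmf \<Rightarrow> ('g edge \<Rightarrow> real) \<Rightarrow> 'g edge \<Rightarrow> real" where
  "harmonic_part G \<Lambda> \<nu> \<omega> = (THE u. u \<in> ell2_forms G \<Lambda> \<nu> \<and> harmonic G \<Lambda> \<nu> u \<and>
     (\<exists>f. \<forall>e \<in> edges G \<Lambda> \<nu>. \<omega> e = u e + differential G \<Lambda> \<nu> f e))"

section \<open>The covariance operator\<close>

definition lattice_part ::
  "('g, 'r) monoid_scheme \<Rightarrow> 'g set \<Rightarrow> 'g set \<Rightarrow> ('g \<Rightarrow> 'v) \<Rightarrow> 'g \<Rightarrow> 'v" where
  "lattice_part G \<Lambda> \<Delta> \<iota> \<gamma> = \<iota> (THE l. l \<in> \<Lambda> \<and> (\<exists>x\<in>\<Delta>. \<gamma> = l \<otimes>\<^bsub>G\<^esub> x))"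

text \<open>\<open>\<Phi>\<^sub>e\<close> is the common value of \<open>\<Phi>(\<gamma>s) - \<Phi>(\<gamma>)\<close> over all \<open>\<gamma>\<close> in the coset where \<open>e\<close>
  starts.\<close>

definition edge_displacement ::
  "('g, 'r) monoid_scheme \<Rightarrow> 'g set \<Rightarrow> 'g set \<Rightarrow> ('g \<Rightarrow> 'v::real_vector) \<Rightarrow> 'g edge \<Rightarrow> 'v" where
  "edge_displacement G \<Lambda> \<Delta> \<iota> e = (THE p. \<forall>\<gamma> \<in> edge_start e.
     lattice_part G \<Lambda> \<Delta> \<iota> (\<gamma> \<otimes>\<^bsub>G\<^esub> snd e) - lattice_part G \<Lambda> \<Delta> \<iota> \<gamma> = p)"

definition hat ::
  "('g, 'r) monoid_scheme \<Rightarrow> 'g set \<Rightarrow> 'g set \<Rightarrow> ('g \<Rightarrow> 'v::real_vector)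
    \<Rightarrow> ('v \<Rightarrow> 'v \<Rightarrow> real) \<Rightarrow> 'g pmf \<Rightarrow> 'v \<Rightarrow> 'g edge \<Rightarrow> real" where
  "hat G \<Lambda> \<Delta> \<iota> ip \<nu> v = (\<lambda>e \<in> edges G \<Lambda> \<nu>. ip v (edge_displacement G \<Lambda> \<Delta> \<iota> e))"

definition covariance_form ::
  "('g, 'r) monoid_scheme \<Rightarrow> 'g set \<Rightarrow> 'g set \<Rightarrow> ('g \<Rightarrow> 'v::real_vector)
    \<Rightarrow> ('v \<Rightarrow> 'v \<Rightarrow> real) \<Rightarrow> 'g pmf \<Rightarrow> 'v \<Rightarrow> 'v \<Rightarrow> real" where
  "covariance_form G \<Lambda> \<Delta> \<iota> ip \<nu> v1 v2 =
     (let u1 = harmonic_part G \<Lambda> \<nu> (hat G \<Lambda> \<Delta> \<iota> ip \<nu> v1);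
          u2 = harmonic_part G \<Lambda> \<nu> (hat G \<Lambda> \<Delta> \<iota> ip \<nu> v2);
          c = edge_weight G \<Lambda> \<nu>
      in (\<Sum>\<^sub>\<infinity>e \<in> edges G \<Lambda> \<nu>. u1 e * u2 e * c e)
         - (\<Sum>\<^sub>\<infinity>e \<in> edges G \<Lambda> \<nu>. u1 e * c e) * (\<Sum>\<^sub>\<infinity>e \<in> edges G \<Lambda> \<nu>. u2 e * c e))"

definition covariance ::
  "('g, 'r) monoid_scheme \<Rightarrow> 'g set \<Rightarrow> 'g set \<Rightarrow> ('g \<Rightarrow> 'v::real_vector)
    \<Rightarrow> ('v \<Rightarrow> 'v \<Rightarrow> real) \<Rightarrow> 'g pmf \<Rightarrow> 'v \<Rightarrow> 'v" where
  "covariance G \<Lambda> \<Delta> \<iota> ip \<nu> = (THE T. linear T \<and>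
     (\<forall>v1 v2. ip v1 (T v2) = covariance_form G \<Lambda> \<Delta> \<iota> ip \<nu> v1 v2))"

end

theory Submission
  imports Defs
begin

text \<open>The harmonic part of a lifted form is the lift of the harmonic part, so the harmonic part \<open>u\<^sub>v\<close>
  belonging to \<open>v\<close> on the quotient graph of \<open>\<Gamma>\<close> also computes those of \<open>(v, 0)\<close> and \<open>(0, v)\<close> on the
  quotient graph of \<open>\<Gamma> \<times> \<Gamma>\<close>. As both marginals of \<open>\<pi>\<^sup>\<rho>\<close> are \<open>\<mu>\<close>, this gives the diagonal blocks. In the
  off-diagonal block the independent part of \<open>\<pi>\<^sup>\<rho>\<close> cancels, and what remains is \<open>1 - \<rho>\<close> times the
  \<open>\<mu>\<close>-covariance of the coset averages of \<open>u\<^sub>v\<close> and \<open>u\<^sub>w\<close>. Measuring displacements with the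
  complement \<open>F\<close> as system of representatives gives \<open>\<Phi>\<^sub>e = Ad(\<Lambda>\<gamma>) \<lambda>\<close> for \<open>e = (\<Lambda>\<gamma>, s)\<close>, \<open>s \<in> \<lambda>F\<close>. So
  \<open>u\<^sub>v\<close> does not depend on the coset if \<open>v\<close> is fixed by \<open>F\<close>, and averages to
  \<open>\<langle>v, \<theta>(\<lambda>)\<rangle> = 0\<close> if \<open>v\<close> is orthogonal to the image of the transfer \<open>\<theta>\<close>.\<close>

section \<open>Finite linear systems\<close>

text \<open>The harmonic part, \<open>Ad\<close>, the displacement of an edge and the covariance
  operator are definite descriptions, so existence and uniqueness must be settled before any
  identity can be read off from them. For harmonic parts the question becomes a Poisson equation on
  the finite set of cosets: linear algebra provides the potential, and a maximum principle makes it
  unique up to constants. The representatives \<Delta> are arbitrary, and displacements measured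
  with them need not be compatible with the action. Changing representatives alters the displacement
  by h(te) - h(oe) for a function h on the cosets, so it alters the form by an exact one, which the
  harmonic part does not see; this permits the passage to \<open>F\<close>. For v orthogonal to the
  range of \<theta> no explicit formula for the harmonic part is used. Only its averages over the
  cosets are, and there every exact form drops out because A -> As permutes the cosets.\<close>

lemma underdetermined_system_nontrivial:
  fixes a :: "'i \<Rightarrow> 'v \<Rightarrow> 'a::field"
  assumes "finite W" "finite V" "card W < card V"
  shows "\<exists>f. (\<exists>y\<in>V. f y \<noteq> 0) \<and> (\<forall>x\<in>W. (\<Sum>y\<in>V. a x y * f y) = 0)"
  using assms
proof (induction W arbitrary: V a rule: finite_induct)
  case empty
  then obtain y where "y \<in> V" by (metis card.empty equals0I less_irrefl)
  then show ?case by (intro exI[of _ "\<lambda>_. 1"]) auto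
next
  case (insert w W)
  show ?case
  proof (cases "\<forall>y\<in>V. a w y = 0")
    case True
    have "card W < card V" using insert.hyps insert.prems by simp
    then obtain f where "\<exists>y\<in>V. f y \<noteq> 0" "\<forall>x\<in>W. (\<Sum>y\<in>V. a x y * f y) = 0"
      using insert.IH[OF insert.prems(1), of a] by metis
    moreover have "(\<Sum>y\<in>V. a w y * f y) = 0"
      using True by (intro sum.neutral) simp
    ultimately show ?thesis by blast
  next
    case False
    then obtain p where p: "p \<in> V" "a w p \<noteq> 0" by auto
    \<comment> \<open>Gaussian elimination: row \<open>w\<close>, with pivot \<open>a w p\<close>,
      clears column \<open>p\<close> from the other rows. The value \<open>t\<close> below is what
      row \<open>w\<close> then forces for the unknown at \<open>p\<close>.\<close>
    define a' where "a' x y = a x y - a x p * a w y / a w p" for x y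
    have "card W < card (V - {p})" using insert.hyps insert.prems p by simp
    moreover have "finite (V - {p})" using insert.prems by simp
    ultimately obtain f where f: "\<exists>y\<in>V-{p}. f y \<noteq> 0" "\<forall>x\<in>W. (\<Sum>y\<in>V-{p}. a' x y * f y) = 0"
      using insert.IH[of "V - {p}" a'] by metis
    define t where "t = - (\<Sum>y\<in>V-{p}. a w y * f y) / a w p"
    define g where "g = f(p := t)"
    have sum_g: "(\<Sum>y\<in>V. a x y * g y) = a x p * t + (\<Sum>y\<in>V-{p}. a x y * f y)" for x
    proof -
      have "(\<Sum>y\<in>V. a x y * g y) = a x p * g p + (\<Sum>y\<in>V-{p}. a x y * g y)"
        using p(1) insert.prems(1) by (simp add: sum.remove)
      also have "(\<Sum>y\<in>V-{p}. a x y * g y) = (\<Sum>y\<in>V-{p}. a x y * f y)"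
        by (intro sum.cong) (auto simp: g_def)
      finally show ?thesis by (simp only: g_def fun_upd_same)
    qed
    have "(\<Sum>y\<in>V. a x y * g y) = 0" if "x \<in> insert w W" for x
    proof (cases "x = w")
      case True
      then show ?thesis using p by (simp add: sum_g t_def)
    next
      case False
      with that f(2) have "0 = (\<Sum>y\<in>V-{p}. a' x y * f y)" by simp
      also have "\<dots> = (\<Sum>y\<in>V-{p}. a x y * f y - a x p / a w p * (a w y * f y))"
        by (intro sum.cong) (simp_all add: a'_def left_diff_distrib mult.assoc)
      also have "\<dots> = (\<Sum>y\<in>V-{p}. a x y * f y) - a x p / a w p * (\<Sum>y\<in>V-{p}. a w y * f y)"
        by (simp only: sum_subtractf sum_distrib_left)
      finally show ?thesis unfolding sum_g by (simp add: t_def)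
    qed
    moreover have "\<exists>y\<in>V. g y \<noteq> 0" using f(1) by (auto simp: g_def)
    ultimately show ?thesis by blast
  qed
qed

text \<open>Injectivity implies surjectivity for a matrix indexed by a bare finite set. Appending
  \<open>- b\<close> as one more column gives more unknowns than equations; injectivity forces the
  entry of a nontrivial kernel vector at the new column to be nonzero, and dividing by it yields the
  solution.\<close>

lemma square_system_solvable:
  fixes a :: "'v \<Rightarrow> 'v \<Rightarrow> 'a::field"
  assumes V: "finite V"
    and inj: "\<And>f. \<forall>x\<in>V. (\<Sum>y\<in>V. a x y * f y) = 0 \<Longrightarrow> \<forall>y\<in>V. f y = 0"
  shows "\<exists>f. \<forall>x\<in>V. (\<Sum>y\<in>V. a x y * f y) = b x"
proof -
  define a' where "a' x z = (case z of None \<Rightarrow> - b x | Some y \<Rightarrow> a x y)" for x z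
  let ?V' = "insert None (Some ` V)"
  have fin: "finite ?V'" using V by simp
  have "card V < card ?V'" using V by (simp add: card_image)
  then obtain g where g: "\<exists>z\<in>?V'. g z \<noteq> 0" "\<forall>x\<in>V. (\<Sum>z\<in>?V'. a' x z * g z) = 0"
    using underdetermined_system_nontrivial[OF V fin, of a'] by metis
  have sum_g: "(\<Sum>y\<in>V. a x y * g (Some y)) = b x * g None" if "x \<in> V" for x
  proof -
    have "0 = (\<Sum>z\<in>?V'. a' x z * g z)" using g(2) that by simp
    also have "\<dots> = - b x * g None + (\<Sum>y\<in>V. a x y * g (Some y))"
      using V by (simp add: sum.reindex a'_def)
    finally show ?thesis by simp
  qed
  have "g None \<noteq> 0"
  proof
    assume "g None = 0"
    moreover from this have "\<forall>y\<in>V. g (Some y) = 0"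
      using inj[of "\<lambda>y. g (Some y)"] sum_g by simp
    ultimately show False using g(1) by simp
  qed
  then have "(\<Sum>y\<in>V. a x y * (g (Some y) / g None)) = b x" if "x \<in> V" for x
    using sum_g[OF that] by (simp flip: sum_divide_distrib)
  then show ?thesis by (intro exI[of _ "\<lambda>y. g (Some y) / g None"]) auto
qed

section \<open>Expectations\<close>

lemma integrable_pmf_iff_abs_summable:
  fixes h :: "'a \<Rightarrow> real"
  shows "integrable (measure_pmf p) h \<longleftrightarrow>
    Infinite_Set_Sum.abs_summable_on (\<lambda>s. pmf p s * h s) UNIV"
  unfolding measure_pmf_eq_density abs_summable_on_def
  by (subst integrable_density) auto

text \<open>The definitions speak of sums over edges, while linearity, domination and almost-sure
  arguments are available for integrals against \<open>measure_pmf\<close>. For real functions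
  summability is absolute summability, so the two languages agree.\<close>

lemma integrable_pmf_iff_summable_on:
  fixes h :: "'a \<Rightarrow> real"
  shows "integrable (measure_pmf p) h \<longleftrightarrow> (\<lambda>s. h s * pmf p s) summable_on UNIV"
  unfolding integrable_pmf_iff_abs_summable
  by (subst summable_on_iff_abs_summable_on_real, subst abs_summable_equivalent)
     (simp only: mult.commute)

lemma pmf_expectation_eq_infsum:
  fixes h :: "'a \<Rightarrow> real"
  assumes "integrable (measure_pmf p) h"
  shows "measure_pmf.expectation p h = (\<Sum>\<^sub>\<infinity>s. h s * pmf p s)"
  using assms unfolding integrable_pmf_iff_abs_summable pmf_expectation_eq_infsetsum
  by (subst infsetsum_infsum) (simp_all only: mult.commute)

lemma integrable_pair_pmf_mult:
  fixes f :: "'a \<Rightarrow> real" and g :: "'b \<Rightarrow> real"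
  assumes f: "integrable (measure_pmf p) f" and g: "integrable (measure_pmf q) g"
  shows "integrable (measure_pmf (pair_pmf p q)) (\<lambda>z. f (fst z) * g (snd z))" (is ?I)
    and "measure_pmf.expectation (pair_pmf p q) (\<lambda>z. f (fst z) * g (snd z)) =
      measure_pmf.expectation p f * measure_pmf.expectation q g" (is ?E)
proof -
  let ?F = "\<lambda>s. pmf p s * f s" and ?G = "\<lambda>t. pmf q t * g t"
  have s: "Infinite_Set_Sum.abs_summable_on ?F (set_pmf p)"
      "Infinite_Set_Sum.abs_summable_on ?G (set_pmf q)"
    using f g unfolding integrable_pmf_iff_abs_summable
    by (blast intro: abs_summable_on_subset)+
  have eq: "(\<lambda>z. pmf (pair_pmf p q) z * (f (fst z) * g (snd z))) = (\<lambda>(s, t). ?F s * ?G t)"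
    by (auto simp: pmf_pair fun_eq_iff)
  \<comment> \<open>Supports are countable although the types need not be, so the product theorem is
    applied on the product of the supports and extended by zero.\<close>
  have zero: "(case z of (s, t) \<Rightarrow> ?F s * ?G t) = 0" if "z \<notin> set_pmf p \<times> set_pmf q" for z
    using that by (cases z) (auto simp: pmf_eq_0_set_pmf)
  have "Infinite_Set_Sum.abs_summable_on (\<lambda>(s, t). ?F s * ?G t) (set_pmf p \<times> set_pmf q)"
    using s by (intro abs_summable_on_product) auto
  then show ?I
    unfolding integrable_pmf_iff_abs_summable eq
    by (rule abs_summable_on_cong_neutral[THEN iffD1, rotated -1]) (use zero in auto)
  have "infsetsum (\<lambda>(s, t). ?F s * ?G t) UNIV =
      infsetsum (\<lambda>(s, t). ?F s * ?G t) (set_pmf p \<times> set_pmf q)"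
    by (rule infsetsum_cong_neutral) (use zero in auto)
  also have "\<dots> = infsetsum ?F (set_pmf p) * infsetsum ?G (set_pmf q)"
    using s by (intro infsetsum_product) auto
  also have "infsetsum ?F (set_pmf p) = infsetsum ?F UNIV"
    by (rule infsetsum_cong_neutral) (auto simp: pmf_eq_0_set_pmf)
  also have "infsetsum ?G (set_pmf q) = infsetsum ?G UNIV"
    by (rule infsetsum_cong_neutral) (auto simp: pmf_eq_0_set_pmf)
  finally show ?E
    unfolding pmf_expectation_eq_infsetsum eq .
qed

lemma integrable_diag_pmf_mult:
  fixes f g :: "'a \<Rightarrow> real"
  shows "integrable (measure_pmf (diag_pmf p)) (\<lambda>z. f (fst z) * g (snd z)) \<longleftrightarrow>
      integrable (measure_pmf p) (\<lambda>s. f s * g s)"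
    and "measure_pmf.expectation (diag_pmf p) (\<lambda>z. f (fst z) * g (snd z)) =
      measure_pmf.expectation p (\<lambda>s. f s * g s)"
  by (simp_all add: diag_pmf_def)

text \<open>The mass function is a convex combination: the independent part factors, the diagonal
  part evaluates both factors at the same group element. This is where \<open>1 - \<rho>\<close>
  enters the covariance.\<close>

lemma integrable_pi_rho_mult:
  fixes f g :: "'a \<Rightarrow> real"
  assumes \<rho>: "0 \<le> \<rho>" "\<rho> \<le> 1"
    and f: "integrable (measure_pmf p) f" and g: "integrable (measure_pmf p) g"
    and fg: "integrable (measure_pmf p) (\<lambda>s. f s * g s)"
  shows "integrable (measure_pmf (pi_rho \<rho> p)) (\<lambda>z. f (fst z) * g (snd z))" (is ?I)
    and "measure_pmf.expectation (pi_rho \<rho> p) (\<lambda>z. f (fst z) * g (snd z)) =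
      \<rho> * (measure_pmf.expectation p f * measure_pmf.expectation p g) +
      (1 - \<rho>) * measure_pmf.expectation p (\<lambda>s. f s * g s)" (is ?E)
proof -
  let ?h = "\<lambda>z. f (fst z) * g (snd z)"
  have eq: "(\<lambda>z. pmf (pi_rho \<rho> p) z * ?h z) =
      (\<lambda>z. \<rho> * (pmf (pair_pmf p p) z * ?h z) + (1 - \<rho>) * (pmf (diag_pmf p) z * ?h z))"
    by (auto simp: pmf_pi_rho[OF \<rho>] pmf_pair pmf_diag_pmf fun_eq_iff algebra_simps)
  have s: "Infinite_Set_Sum.abs_summable_on (\<lambda>z. pmf (pair_pmf p p) z * ?h z) UNIV"
    "Infinite_Set_Sum.abs_summable_on (\<lambda>z. pmf (diag_pmf p) z * ?h z) UNIV"
    using integrable_pair_pmf_mult(1)[OF f g] integrable_diag_pmf_mult(1)[THEN iffD2, OF fg]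
    unfolding integrable_pmf_iff_abs_summable .
  show ?I
    unfolding integrable_pmf_iff_abs_summable eq
    by (intro abs_summable_on_add abs_summable_on_cmult_right s)
  have "measure_pmf.expectation (pi_rho \<rho> p) ?h =
      \<rho> * measure_pmf.expectation (pair_pmf p p) ?h +
      (1 - \<rho>) * measure_pmf.expectation (diag_pmf p) ?h"
    unfolding pmf_expectation_eq_infsetsum eq
    by (simp only: infsetsum_add infsetsum_cmult_right s abs_summable_on_cmult_right)
  then show ?E
    unfolding integrable_pair_pmf_mult(2)[OF f g] integrable_diag_pmf_mult(2) .
qed

lemma map_pmf_fst_pi_rho: "map_pmf fst (pi_rho \<rho> p) = p"
  and map_pmf_snd_pi_rho: "map_pmf snd (pi_rho \<rho> p) = p"
proof -
  have "map_pmf fst (diag_pmf p) = p" "map_pmf snd (diag_pmf p) = p"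
    by (simp_all add: diag_pmf_def pmf.map_comp o_def)
  then show "map_pmf fst (pi_rho \<rho> p) = p" "map_pmf snd (pi_rho \<rho> p) = p"
    by (simp_all add: pi_rho_def map_bind_pmf if_distrib map_fst_pair_pmf map_snd_pair_pmf cong: if_cong)
qed

lemma integrable_pmf_mult:
  fixes f g :: "'a \<Rightarrow> real"
  assumes "integrable (measure_pmf p) (\<lambda>s. (f s)\<^sup>2)" "integrable (measure_pmf p) (\<lambda>s. (g s)\<^sup>2)"
  shows "integrable (measure_pmf p) (\<lambda>s. f s * g s)"
proof (rule Bochner_Integration.integrable_bound)
  show "integrable (measure_pmf p) (\<lambda>s. (f s)\<^sup>2 + (g s)\<^sup>2)" using assms by auto
  have "\<bar>x * y\<bar> \<le> x\<^sup>2 + y\<^sup>2" for x y :: real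
    using sum_squares_bound[of "\<bar>x\<bar>" "\<bar>y\<bar>"] by (simp add: abs_mult mult.assoc)
       (smt (verit) abs_ge_zero mult_nonneg_nonneg)
  then show "AE s in measure_pmf p. norm (f s * g s) \<le> norm ((f s)\<^sup>2 + (g s)\<^sup>2)"
    by (simp add: order_trans[OF _ abs_ge_self])
qed simp

lemma integrable_pmf_if_square_integrable:
  fixes f :: "'a \<Rightarrow> real"
  assumes "integrable (measure_pmf p) (\<lambda>s. (f s)\<^sup>2)"
  shows "integrable (measure_pmf p) f"
  using integrable_pmf_mult[of p f "\<lambda>_. 1"] assms by simp

lemma square_integrable_pmf_add:
  fixes f g :: "'a \<Rightarrow> real"
  assumes "integrable (measure_pmf p) (\<lambda>s. (f s)\<^sup>2)" "integrable (measure_pmf p) (\<lambda>s. (g s)\<^sup>2)"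
  shows "integrable (measure_pmf p) (\<lambda>s. (a * f s + b * g s)\<^sup>2)"
proof -
  have "(\<lambda>s. (a * f s + b * g s)\<^sup>2) =
      (\<lambda>s. a\<^sup>2 * (f s)\<^sup>2 + b\<^sup>2 * (g s)\<^sup>2 + 2 * a * b * (f s * g s))"
    by (auto simp: power2_eq_square algebra_simps)
  then show ?thesis using assms integrable_pmf_mult[OF assms] by simp
qed

lemma integrable_pmf_finite_range:
  fixes f :: "'a \<Rightarrow> real"
  assumes "finite (f ` set_pmf p)"
  shows "integrable (measure_pmf p) f"
proof (rule measure_pmf.integrable_const_bound)
  show "AE s in measure_pmf p. norm (f s) \<le> Max (norm ` f ` set_pmf p)"
    using assms unfolding AE_measure_pmf_iff by (blast intro: Max_ge finite_imageI)
qed simp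

section \<open>Harmonic parts on the quotient graph\<close>

lemma has_sum_Times_finite:
  fixes g :: "'a \<times> 'b \<Rightarrow> 'c::topological_comm_monoid_add"
  assumes "finite A" "\<And>x. x \<in> A \<Longrightarrow> ((\<lambda>s. g (x, s)) has_sum I x) B"
  shows "(g has_sum (\<Sum>x\<in>A. I x)) (A \<times> B)"
  using assms
proof (induction rule: finite_induct)
  case (insert x A)
  have "(g has_sum I x) (Pair x ` B)"
    using insert.prems by (subst has_sum_reindex) (auto simp: o_def inj_on_def)
  moreover have "(g has_sum (\<Sum>x\<in>A. I x)) (A \<times> B)" using insert by auto
  ultimately have "(g has_sum (I x + (\<Sum>x\<in>A. I x))) (Pair x ` B \<union> A \<times> B)"
    using insert.hyps by (intro has_sum_Un_disjoint) auto
  moreover have "Pair x ` B \<union> A \<times> B = insert x A \<times> B" by auto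
  ultimately show ?case using insert.hyps by simp
qed simp

lemma pmf_integrable_cong:
  assumes "\<And>s. s \<in> set_pmf p \<Longrightarrow> f s = g s"
  shows "integrable (measure_pmf p) f \<longleftrightarrow> integrable (measure_pmf p) (g :: _ \<Rightarrow> real)"
  using assms by (intro integrable_cong_AE AE_pmfI) auto

lemma pmf_expectation_cong:
  assumes "\<And>s. s \<in> set_pmf p \<Longrightarrow> f s = g s"
  shows "measure_pmf.expectation p f = measure_pmf.expectation p (g :: _ \<Rightarrow> real)"
  using assms by (intro integral_cong_AE AE_pmfI) auto

text \<open>Kept free of the lattice embedding so that it can be instantiated both at the given
  group and at its square, and so that the two can be compared by a morphism.\<close>

locale weighted_quotient = normal \<Lambda> G
  for \<Lambda> and G (structure) +
  fixes \<nu> :: "'a pmf"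
  assumes finite_rcosets: "finite (rcosets \<Lambda>)"
    and support: "set_pmf \<nu> \<subseteq> carrier G"
    and generated: "semigroup_generated G (set_pmf \<nu>) = carrier G"
begin

abbreviation "V \<equiv> rcosets \<Lambda>"
abbreviation "steps \<equiv> set_pmf \<nu> \<union> inverses G (set_pmf \<nu>)"
abbreviation "E h \<equiv> measure_pmf.expectation \<nu> (h :: 'a \<Rightarrow> real)"
abbreviation "L1 h \<equiv> integrable (measure_pmf \<nu>) (h :: 'a \<Rightarrow> real)"
abbreviation "N \<equiv> real (card V)"

lemma steps_carrier: "steps \<subseteq> carrier G"
  using support by (auto simp: inverses_def)

lemma inv_steps: "s \<in> steps \<Longrightarrow> inv s \<in> steps"
  using support by (auto simp: inverses_def)

lemma coset_step: "x \<in> V \<Longrightarrow> s \<in> carrier G \<Longrightarrow> x #> s \<in> V"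
  by (auto simp: RCOSETS_def coset_mult_assoc[OF subset])

lemma vertex_carrier: "x \<in> V \<Longrightarrow> x \<subseteq> carrier G"
  using rcosets_part_G subgroup_axioms by auto

lemma coset_step_step:
  "x \<in> V \<Longrightarrow> s \<in> carrier G \<Longrightarrow> t \<in> carrier G \<Longrightarrow> x #> s #> t = x #> (s \<otimes> t)"
  by (simp add: coset_mult_assoc vertex_carrier)

lemma coset_step_inv: "x \<in> V \<Longrightarrow> s \<in> carrier G \<Longrightarrow> x #> s #> inv s = x"
  by (simp add: coset_step_step vertex_carrier)

lemma N_pos: "N > 0"
  using finite_rcosets coset_mult_one[OF subset] rcosetsI[OF subset one_closed]
  by (metis card_gt_0_iff empty_iff of_nat_0_less_iff)

lemma bij_coset_step:
  assumes "s \<in> carrier G"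
  shows "bij_betw (\<lambda>x. x #> s) V V"
  using assms coset_step_inv[of _ "inv s"]
  by (intro bij_betwI[where g = "\<lambda>x. x #> inv s"]) (auto simp: coset_step coset_step_inv)

lemma sum_coset_step: "s \<in> carrier G \<Longrightarrow> (\<Sum>x\<in>V. f (x #> s)) = (\<Sum>x\<in>V. f x)"
  by (rule sum.reindex_bij_betw[OF bij_coset_step])

section \<open>Sums over edges as expectations under the step law\<close>

lemma mem_edges: "(x, s) \<in> edges G \<Lambda> \<nu> \<longleftrightarrow> x \<in> V \<and> s \<in> steps"
  by (simp add: edges_def)

lemma edge_rev_edges: "e \<in> edges G \<Lambda> \<nu> \<Longrightarrow> edge_rev G e \<in> edges G \<Lambda> \<nu>"
  using steps_carrier by (cases e) (auto simp: mem_edges edge_rev_def coset_step inv_steps simp del: Un_iff)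

lemma edge_weight_eq: "edge_weight G \<Lambda> \<nu> (x, s) = pmf \<nu> s / N"
  by (simp add: edge_weight_def vertex_weight_def)

text \<open>Inverse steps are included so that the edge set is closed under reversal, but outside
  the support they carry weight zero; hence sums over \<open>steps\<close> are expectations.\<close>

lemma has_sum_steps:
  assumes "L1 h"
  shows "((\<lambda>s. h s * pmf \<nu> s) has_sum E h) steps"
proof -
  have "((\<lambda>s. h s * pmf \<nu> s) has_sum E h) UNIV"
    using assms by (simp add: has_sum_iff pmf_expectation_eq_infsum integrable_pmf_iff_summable_on)
  then show ?thesis
    by (rule has_sum_cong_neutral[THEN iffD1, rotated -1]) (auto simp: pmf_eq_0_set_pmf)
qed

lemma has_sum_edges:
  assumes "\<And>x. x \<in> V \<Longrightarrow> L1 (\<lambda>s. h (x, s))"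
  shows "((\<lambda>e. h e * edge_weight G \<Lambda> \<nu> e) has_sum (\<Sum>x\<in>V. E (\<lambda>s. h (x, s))) / N) (edges G \<Lambda> \<nu>)"
  unfolding edges_def sum_divide_distrib
proof (rule has_sum_Times_finite[OF finite_rcosets])
  fix x assume "x \<in> V"
  from has_sum_cmult_right[OF has_sum_steps[OF assms[OF this]], of "1 / N"]
  show "((\<lambda>s. h (x, s) * edge_weight G \<Lambda> \<nu> (x, s)) has_sum E (\<lambda>s. h (x, s)) / N) steps"
    by (simp add: edge_weight_eq mult.commute)
qed

lemmas infsum_edges = infsumI[OF has_sum_edges]

lemma L1_if_summable_edges:
  assumes "(\<lambda>e. h e * edge_weight G \<Lambda> \<nu> e) summable_on edges G \<Lambda> \<nu>" and x: "x \<in> V"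
  shows "L1 (\<lambda>s. h (x, s))"
proof -
  have "(\<lambda>e. h e * edge_weight G \<Lambda> \<nu> e) summable_on (Pair x ` steps)"
    by (rule summable_on_subset_banach[OF assms(1)]) (use x in \<open>auto simp: mem_edges\<close>)
  then have "(\<lambda>s. h (x, s) * (pmf \<nu> s / N)) summable_on steps"
    by (subst (asm) summable_on_reindex) (auto simp: inj_on_def o_def edge_weight_eq)
  from summable_on_cmult_right[OF this, of N]
  have "(\<lambda>s. h (x, s) * pmf \<nu> s) summable_on steps"
    using N_pos by (simp add: mult.commute mult.left_commute)
  then show ?thesis
    unfolding integrable_pmf_iff_summable_on
    by (rule summable_on_cong_neutral[THEN iffD1, rotated -1]) (auto simp: pmf_eq_0_set_pmf)
qed

text \<open>There are finitely many vertices, so square summability over the edges splits into one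
  integrability condition per vertex.\<close>

lemma ell2_iff:
  "\<omega> \<in> ell2_forms G \<Lambda> \<nu> \<longleftrightarrow>
     \<omega> \<in> one_forms G \<Lambda> \<nu> \<and> (\<forall>x\<in>V. L1 (\<lambda>s. (\<omega> (x, s))\<^sup>2))"
  unfolding ell2_forms_def
  using L1_if_summable_edges[of "\<lambda>e. (\<omega> e)\<^sup>2"] has_sum_edges[of "\<lambda>e. (\<omega> e)\<^sup>2"]
  by (auto simp: summable_on_def)

lemma ell2_square_integrable: "\<omega> \<in> ell2_forms G \<Lambda> \<nu> \<Longrightarrow> x \<in> V \<Longrightarrow> L1 (\<lambda>s. (\<omega> (x, s))\<^sup>2)"
  by (simp add: ell2_iff)

lemma ell2_integrable: "\<omega> \<in> ell2_forms G \<Lambda> \<nu> \<Longrightarrow> x \<in> V \<Longrightarrow> L1 (\<lambda>s. \<omega> (x, s))"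
  by (rule integrable_pmf_if_square_integrable, rule ell2_square_integrable)

lemma chi_eq:
  "\<omega> \<in> ell2_forms G \<Lambda> \<nu> \<Longrightarrow> chi G \<Lambda> \<nu> \<omega> = (\<Sum>x\<in>V. E (\<lambda>s. \<omega> (x, s))) / N"
  unfolding chi_def by (rule infsum_edges) (rule ell2_integrable)

lemma codifferential_eq:
  assumes \<omega>: "\<omega> \<in> ell2_forms G \<Lambda> \<nu>" and x: "x \<in> V"
  shows "codifferential G \<Lambda> \<nu> \<omega> x = - E (\<lambda>s. \<omega> (x, s))"
proof -
  have star: "{e \<in> edges G \<Lambda> \<nu>. edge_start e = x} = Pair x ` steps"
    using x by (auto simp: edges_def edge_start_def)
  have "(\<Sum>\<^sub>\<infinity>e\<in>Pair x ` steps. edge_weight G \<Lambda> \<nu> e * \<omega> e) =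
      (\<Sum>\<^sub>\<infinity>s\<in>steps. 1 / N * (\<omega> (x, s) * pmf \<nu> s))"
    by (subst infsum_reindex) (auto simp: inj_on_def o_def edge_weight_eq mult.commute)
  also have "\<dots> = 1 / N * E (\<lambda>s. \<omega> (x, s))"
    by (intro infsumI has_sum_cmult_right has_sum_steps ell2_integrable[OF \<omega> x])
  finally show ?thesis
    using N_pos by (simp add: codifferential_def star vertex_weight_def)
qed

lemma harmonic_iff:
  assumes "\<omega> \<in> ell2_forms G \<Lambda> \<nu>"
  shows "harmonic G \<Lambda> \<nu> \<omega> \<longleftrightarrow> (\<forall>x\<in>V. E (\<lambda>s. \<omega> (x, s)) = chi G \<Lambda> \<nu> \<omega>)"
  unfolding harmonic_def using codifferential_eq[OF assms] by auto

text \<open>The common value need not be identified beforehand: \<open>chi\<close> is the average of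
  the vertex means, so it equals \<open>k\<close> automatically.\<close>

lemma harmonicI:
  assumes \<omega>: "\<omega> \<in> ell2_forms G \<Lambda> \<nu>" and k: "\<And>x. x \<in> V \<Longrightarrow> E (\<lambda>s. \<omega> (x, s)) = k"
  shows "harmonic G \<Lambda> \<nu> \<omega>"
  using N_pos k by (simp add: harmonic_iff[OF \<omega>] chi_eq[OF \<omega>])

lemma ell2_linear:
  assumes "\<omega>1 \<in> ell2_forms G \<Lambda> \<nu>" "\<omega>2 \<in> ell2_forms G \<Lambda> \<nu>"
  shows "(\<lambda>e\<in>edges G \<Lambda> \<nu>. a * \<omega>1 e + b * \<omega>2 e) \<in> ell2_forms G \<Lambda> \<nu>" (is "?\<omega> \<in> _")
proof -
  have "?\<omega> \<in> one_forms G \<Lambda> \<nu>"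
    using assms by (auto simp: ell2_iff one_forms_def edge_rev_edges)
  moreover have "L1 (\<lambda>s. (?\<omega> (x, s))\<^sup>2)" if "x \<in> V" for x
  proof -
    have "L1 (\<lambda>s. (a * \<omega>1 (x, s) + b * \<omega>2 (x, s))\<^sup>2)"
      using assms that by (intro square_integrable_pmf_add) (auto simp: ell2_iff)
    then show ?thesis
      by (rule pmf_integrable_cong[THEN iffD1, rotated]) (use that in \<open>auto simp: mem_edges\<close>)
  qed
  ultimately show ?thesis by (simp add: ell2_iff)
qed

section \<open>The averaging operator of the walk on the cosets and its Poisson equation\<close>

lemma L1_vertex_function: "x \<in> V \<Longrightarrow> L1 (\<lambda>s. f (x #> s))"
  by (rule integrable_pmf_finite_range, rule finite_subset[of _ "f ` V"])
     (use support in \<open>auto simp: finite_rcosets intro!: imageI coset_step\<close>)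

lemma differential_ell2: "differential G \<Lambda> \<nu> f \<in> ell2_forms G \<Lambda> \<nu>"
proof -
  have "differential G \<Lambda> \<nu> f (edge_rev G e) = - differential G \<Lambda> \<nu> f e"
    if e: "e \<in> edges G \<Lambda> \<nu>" for e
  proof -
    have "fst e \<in> V" "snd e \<in> carrier G" using e steps_carrier by (auto simp: edges_def)
    then show ?thesis
      using e edge_rev_edges[OF e]
      by (simp add: differential_def edge_end_def edge_start_def edge_rev_def coset_step_inv)
  qed
  then have "differential G \<Lambda> \<nu> f \<in> one_forms G \<Lambda> \<nu>"
    by (simp add: one_forms_def) (simp add: differential_def)
  moreover have "L1 (\<lambda>s. (differential G \<Lambda> \<nu> f (x, s))\<^sup>2)" if "x \<in> V" for x
    using L1_vertex_function[OF that, of "\<lambda>y. (f y - f x)\<^sup>2"]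
    by (rule pmf_integrable_cong[THEN iffD1, rotated])
       (use that in \<open>auto simp: differential_def mem_edges edge_end_def edge_start_def\<close>)
  ultimately show ?thesis by (simp add: ell2_iff)
qed

lemma E_differential:
  assumes "x \<in> V"
  shows "E (\<lambda>s. differential G \<Lambda> \<nu> f (x, s)) = E (\<lambda>s. f (x #> s)) - f x"
proof -
  have "E (\<lambda>s. differential G \<Lambda> \<nu> f (x, s)) = E (\<lambda>s. f (x #> s) - f x)"
    by (rule pmf_expectation_cong)
       (use assms in \<open>auto simp: differential_def mem_edges edge_end_def edge_start_def\<close>)
  then show ?thesis using L1_vertex_function[OF assms] by simp
qed

text \<open>The uniform measure on the cosets is stationary because each single step already
  permutes them.\<close>

lemma sum_E_coset_step: "(\<Sum>x\<in>V. E (\<lambda>s. f (x #> s))) = (\<Sum>x\<in>V. f x)"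
proof -
  have "(\<Sum>x\<in>V. E (\<lambda>s. f (x #> s))) = E (\<lambda>s. \<Sum>x\<in>V. f (x #> s))"
    by (subst Bochner_Integration.integral_sum) (auto intro: L1_vertex_function)
  also have "\<dots> = E (\<lambda>s. \<Sum>x\<in>V. f x)"
    by (rule pmf_expectation_cong) (use support in \<open>auto intro: sum_coset_step\<close>)
  finally show ?thesis by simp
qed

text \<open>Maximum principle: the set where \<open>g\<close> is maximal is closed under the steps of the walk,
  which act transitively.\<close>

lemma fixed_functions_constant:
  assumes g: "\<And>x. x \<in> V \<Longrightarrow> E (\<lambda>s. g (x #> s)) = g x"
    and "x \<in> V" "y \<in> V"
  shows "g x = g y"
proof -
  define M where "M = Max (g ` V)"
  have le_M: "g x \<le> M" if "x \<in> V" for x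
    unfolding M_def using that finite_rcosets by (intro Max_ge) auto
  have "M \<in> g ` V"
    unfolding M_def using assms(2) finite_rcosets by (intro Max_in) auto
  then obtain z where z: "z \<in> V" "g z = M" by auto
  have closed: "\<forall>x\<in>V. g x = M \<longrightarrow> g (x #> t) = M" if "t \<in> semigroup_generated G (set_pmf \<nu>)" for t
    using that
  proof induction
    case (base t)
    show ?case
    proof (intro ballI impI)
      fix x assume x: "x \<in> V" "g x = M"
      \<comment> \<open>A nonnegative variable of mean zero vanishes at every atom of \<nu>, so the
        maximum is attained at each neighbour reached by a step of the support.\<close>
      have "E (\<lambda>s. M - g (x #> s)) = 0"
        using L1_vertex_function[OF x(1)] g[OF x(1)] x(2) by simp
      moreover have "AE s in measure_pmf \<nu>. 0 \<le> M - g (x #> s)"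
      proof (rule AE_pmfI)
        fix s assume "s \<in> set_pmf \<nu>"
        then have "x #> s \<in> V" using support x(1) coset_step by blast
        then show "0 \<le> M - g (x #> s)" using le_M by simp
      qed
      ultimately have "AE s in measure_pmf \<nu>. M - g (x #> s) = 0"
        using L1_vertex_function[OF x(1)] by (subst (asm) integral_nonneg_eq_0_iff_AE) auto
      then have "M - g (x #> t) = 0" using base unfolding AE_measure_pmf_iff by blast
      then show "g (x #> t) = M" by simp
    qed
  next
    case (mult s t)
    then have "s \<in> carrier G" "t \<in> carrier G" unfolding generated by blast+
    show ?case
    proof (intro ballI impI)
      fix x assume x: "x \<in> V" "g x = M"
      then have "g (x #> s #> t) = M"
        using mult.IH coset_step[OF x(1) \<open>s \<in> carrier G\<close>] by blast
      then show "g (x #> (s \<otimes> t)) = M"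
        using coset_step_step[OF x(1) \<open>s \<in> carrier G\<close> \<open>t \<in> carrier G\<close>] by simp
    qed
  qed
  have step: "g (x #> t) = M" if "x \<in> V" "g x = M" "t \<in> carrier G" for x t
    using that closed[of t] unfolding generated by blast
  have "g x = M" if x: "x \<in> V" for x
  proof -
    obtain a where a: "a \<in> carrier G" "z = \<Lambda> #> a" using z(1) by (auto simp: RCOSETS_def)
    obtain b where b: "b \<in> carrier G" "x = \<Lambda> #> b" using x by (auto simp: RCOSETS_def)
    have "a \<otimes> (inv a \<otimes> b) = b"
      using a(1) b(1) by (metis inv_closed l_one m_assoc r_inv)
    then have "z #> (inv a \<otimes> b) = x"
      using a b by (simp add: coset_mult_assoc[OF subset])
    then show ?thesis using step[OF z, of "inv a \<otimes> b"] a(1) b(1) by simp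
  qed
  from this[OF assms(2)] this[OF assms(3)] show ?thesis by simp
qed

text \<open>Adding the sum of \<open>f\<close> makes the operator \<open>P - 1\<close> injective, so the square system is solvable;
  summing over all vertices shows that the solution has sum zero.\<close>

lemma poisson_equation_solvable:
  assumes b: "(\<Sum>x\<in>V. b x) = 0"
  shows "\<exists>f. \<forall>x\<in>V. E (\<lambda>s. f (x #> s)) - f x = b x"
proof -
  define a where "a x y = E (\<lambda>s. of_bool (x #> s = y)) - of_bool (x = y) + 1" for x y
  have delta: "(\<Sum>y\<in>V. of_bool (z = y) * f y) = f z" if "z \<in> V" for z and f :: "_ \<Rightarrow> real"
  proof -
    have "(\<Sum>y\<in>V. of_bool (z = y) * f y) = (\<Sum>y\<in>V. if y = z then f y else 0)"
      by (rule sum.cong) auto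
    then show ?thesis using that finite_rcosets by simp
  qed
  have a_sum: "(\<Sum>y\<in>V. a x y * f y) = E (\<lambda>s. f (x #> s)) - f x + (\<Sum>y\<in>V. f y)"
    if "x \<in> V" for f x
  proof -
    have "E (\<lambda>s. f (x #> s)) = E (\<lambda>s. \<Sum>y\<in>V. of_bool (x #> s = y) * f y)"
    proof (rule pmf_expectation_cong)
      fix s assume "s \<in> set_pmf \<nu>"
      then have "x #> s \<in> V" using support that coset_step by blast
      then show "f (x #> s) = (\<Sum>y\<in>V. of_bool (x #> s = y) * f y)" by (simp only: delta)
    qed
    also have "\<dots> = (\<Sum>y\<in>V. E (\<lambda>s. of_bool (x #> s = y)) * f y)"
      by (subst Bochner_Integration.integral_sum) (auto intro!: integrable_mult_left L1_vertex_function that)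
    finally show ?thesis
      by (simp add: a_def distrib_right left_diff_distrib sum.distrib sum_subtractf delta[OF that]
          del: of_bool_eq_0_iff)
  qed
  have total: "(\<Sum>x\<in>V. E (\<lambda>s. f (x #> s)) - f x + (\<Sum>y\<in>V. f y)) = N * (\<Sum>y\<in>V. f y)" for f
    by (simp add: sum.distrib sum_subtractf sum_E_coset_step)
  have inj: "\<forall>y\<in>V. f y = 0" if f: "\<forall>x\<in>V. (\<Sum>y\<in>V. a x y * f y) = 0" for f
  proof -
    have "N * (\<Sum>y\<in>V. f y) = 0"
      unfolding total[symmetric] using f by (simp add: a_sum)
    then have s0: "(\<Sum>y\<in>V. f y) = 0" using N_pos by simp
    then have "E (\<lambda>s. f (x #> s)) = f x" if "x \<in> V" for x
      using f that by (simp add: a_sum)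
    then have const: "f x = f y" if "x \<in> V" "y \<in> V" for x y
      using fixed_functions_constant that by blast
    show ?thesis
    proof
      fix y assume "y \<in> V"
      then have "(\<Sum>x\<in>V. f x) = (\<Sum>x\<in>V. f y)" by (intro sum.cong refl const)
      then show "f y = 0" using s0 N_pos by simp
    qed
  qed
  obtain f where f: "\<forall>x\<in>V. (\<Sum>y\<in>V. a x y * f y) = b x"
    using square_system_solvable[where a = a and b = b, OF finite_rcosets inj] by blast
  then have "N * (\<Sum>y\<in>V. f y) = 0"
    unfolding total[symmetric] using b by (simp add: a_sum)
  then have "(\<Sum>y\<in>V. f y) = 0" using N_pos by simp
  then show ?thesis using f by (auto simp: a_sum)
qed

section \<open>Existence and uniqueness of harmonic parts\<close>

definition is_harmonic_part :: "('a edge \<Rightarrow> real) \<Rightarrow> ('a edge \<Rightarrow> real) \<Rightarrow> bool" where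
  "is_harmonic_part \<omega> u \<longleftrightarrow> u \<in> ell2_forms G \<Lambda> \<nu> \<and> harmonic G \<Lambda> \<nu> u \<and>
     (\<exists>f. \<forall>e \<in> edges G \<Lambda> \<nu>. \<omega> e = u e + differential G \<Lambda> \<nu> f e)"

text \<open>Subtract the differential of a potential that solves the Poisson equation for the
  deviation of the vertex means from \<open>chi\<close>. The deviations sum to zero, which is
  exactly the solvability condition.\<close>

lemma is_harmonic_part_exists:
  assumes \<omega>: "\<omega> \<in> ell2_forms G \<Lambda> \<nu>"
  shows "\<exists>u. is_harmonic_part \<omega> u"
proof -
  have "(\<Sum>x\<in>V. E (\<lambda>s. \<omega> (x, s)) - chi G \<Lambda> \<nu> \<omega>) = 0"
    using N_pos by (simp add: chi_eq[OF \<omega>] sum_subtractf)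
  from poisson_equation_solvable[OF this] obtain f where
    f: "\<And>x. x \<in> V \<Longrightarrow> E (\<lambda>s. f (x #> s)) - f x = E (\<lambda>s. \<omega> (x, s)) - chi G \<Lambda> \<nu> \<omega>"
    by auto
  define u where "u = (\<lambda>e\<in>edges G \<Lambda> \<nu>. 1 * \<omega> e + (-1) * differential G \<Lambda> \<nu> f e)"
  have u: "u \<in> ell2_forms G \<Lambda> \<nu>"
    unfolding u_def by (intro ell2_linear \<omega> differential_ell2)
  have "E (\<lambda>s. u (x, s)) = chi G \<Lambda> \<nu> \<omega>" if x: "x \<in> V" for x
  proof -
    have "E (\<lambda>s. u (x, s)) = E (\<lambda>s. \<omega> (x, s) - differential G \<Lambda> \<nu> f (x, s))"
      by (rule pmf_expectation_cong) (use x in \<open>auto simp: u_def mem_edges\<close>)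
    also have "\<dots> = E (\<lambda>s. \<omega> (x, s)) - (E (\<lambda>s. f (x #> s)) - f x)"
      using ell2_integrable[OF \<omega> x] ell2_integrable[OF differential_ell2 x]
      by (simp add: E_differential[OF x])
    finally show ?thesis using f[OF x] by simp
  qed
  then have "harmonic G \<Lambda> \<nu> u" by (rule harmonicI[OF u])
  moreover have "\<forall>e\<in>edges G \<Lambda> \<nu>. \<omega> e = u e + differential G \<Lambda> \<nu> f e" by (simp add: u_def)
  ultimately show ?thesis using u unfolding is_harmonic_part_def by blast
qed

text \<open>Two candidates differ by an exact form dg, and harmonicity of both makes Pg - g a
  constant \<open>k\<close>, where P is the averaging operator. Summing against the stationary
  uniform measure gives k = 0, so g is fixed by P, hence constant, and dg = 0. Extensionality turns
  agreement on edges into equality of functions.\<close>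

lemma is_harmonic_part_unique:
  assumes "is_harmonic_part \<omega> u" "is_harmonic_part \<omega> u'"
  shows "u = u'"
proof -
  obtain f where u: "u \<in> ell2_forms G \<Lambda> \<nu>" "harmonic G \<Lambda> \<nu> u"
      "\<forall>e\<in>edges G \<Lambda> \<nu>. \<omega> e = u e + differential G \<Lambda> \<nu> f e"
    using assms(1) unfolding is_harmonic_part_def by blast
  obtain f' where u': "u' \<in> ell2_forms G \<Lambda> \<nu>" "harmonic G \<Lambda> \<nu> u'"
      "\<forall>e\<in>edges G \<Lambda> \<nu>. \<omega> e = u' e + differential G \<Lambda> \<nu> f' e"
    using assms(2) unfolding is_harmonic_part_def by blast
  define g where "g x = f x - f' x" for x
  have diff: "u' e = u e + differential G \<Lambda> \<nu> g e" if "e \<in> edges G \<Lambda> \<nu>" for e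
    using u(3)[rule_format, OF that] u'(3)[rule_format, OF that] that by (simp add: differential_def g_def)
  define k where "k = chi G \<Lambda> \<nu> u' - chi G \<Lambda> \<nu> u"
  have gk: "E (\<lambda>s. g (x #> s)) - g x = k" if x: "x \<in> V" for x
  proof -
    have "E (\<lambda>s. u' (x, s)) = E (\<lambda>s. u (x, s) + differential G \<Lambda> \<nu> g (x, s))"
      by (rule pmf_expectation_cong) (use x in \<open>auto simp: diff mem_edges\<close>)
    also have "\<dots> = E (\<lambda>s. u (x, s)) + (E (\<lambda>s. g (x #> s)) - g x)"
      using ell2_integrable[OF u(1) x] ell2_integrable[OF differential_ell2 x]
      by (simp add: E_differential[OF x])
    finally show ?thesis
      using u(2) u'(2) x by (simp add: harmonic_iff[OF u(1)] harmonic_iff[OF u'(1)] k_def)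
  qed
  have "(\<Sum>x\<in>V. E (\<lambda>s. g (x #> s)) - g x) = 0"
    by (simp add: sum_subtractf sum_E_coset_step)
  then have k0: "k = 0" using gk N_pos by simp
  have fixed: "E (\<lambda>s. g (x #> s)) = g x" if "x \<in> V" for x
    using gk[OF that] k0 by simp
  have const: "g x = g y" if "x \<in> V" "y \<in> V" for x y
    by (rule fixed_functions_constant[OF fixed that])
  have "differential G \<Lambda> \<nu> g (x, s) = 0" if "(x, s) \<in> edges G \<Lambda> \<nu>" for x s
  proof -
    have "x \<in> V" "s \<in> carrier G" using that steps_carrier by (auto simp: mem_edges)
    then show ?thesis
      using that const[of "x #> s" x] by (simp add: differential_def edge_end_def edge_start_def coset_step)
  qed
  then have "u' e = u e" if "e \<in> edges G \<Lambda> \<nu>" for e using diff[OF that] that by (cases e) simp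
  then show ?thesis
    using u(1) u'(1) unfolding ell2_iff one_forms_def
    by (intro extensionalityI[of _ "edges G \<Lambda> \<nu>"]) auto
qed

lemma harmonic_part_eqI: "is_harmonic_part \<omega> u \<Longrightarrow> harmonic_part G \<Lambda> \<nu> \<omega> = u"
  unfolding harmonic_part_def
  unfolding is_harmonic_part_def[symmetric]
  by (rule the_equality) (blast intro: is_harmonic_part_unique)+

lemma is_harmonic_part_harmonic_part:
  "\<omega> \<in> ell2_forms G \<Lambda> \<nu> \<Longrightarrow> is_harmonic_part \<omega> (harmonic_part G \<Lambda> \<nu> \<omega>)"
  using is_harmonic_part_exists harmonic_part_eqI by metis

lemma is_harmonic_part_linear:
  assumes u: "is_harmonic_part \<omega>1 u1" "is_harmonic_part \<omega>2 u2"
  shows "is_harmonic_part (\<lambda>e\<in>edges G \<Lambda> \<nu>. a * \<omega>1 e + b * \<omega>2 e) (\<lambda>e\<in>edges G \<Lambda> \<nu>. a * u1 e + b * u2 e)"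
    (is "is_harmonic_part ?\<omega> ?u")
proof -
  obtain f1 where f1: "\<forall>e\<in>edges G \<Lambda> \<nu>. \<omega>1 e = u1 e + differential G \<Lambda> \<nu> f1 e"
    using u(1) unfolding is_harmonic_part_def by blast
  obtain f2 where f2: "\<forall>e\<in>edges G \<Lambda> \<nu>. \<omega>2 e = u2 e + differential G \<Lambda> \<nu> f2 e"
    using u(2) unfolding is_harmonic_part_def by blast
  have ell2: "u1 \<in> ell2_forms G \<Lambda> \<nu>" "u2 \<in> ell2_forms G \<Lambda> \<nu>"
    and harm: "harmonic G \<Lambda> \<nu> u1" "harmonic G \<Lambda> \<nu> u2"
    using u by (auto simp: is_harmonic_part_def)
  have "E (\<lambda>s. ?u (x, s)) = a * chi G \<Lambda> \<nu> u1 + b * chi G \<Lambda> \<nu> u2" if x: "x \<in> V" for x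
  proof -
    have "E (\<lambda>s. ?u (x, s)) = E (\<lambda>s. a * u1 (x, s) + b * u2 (x, s))"
      by (rule pmf_expectation_cong) (use x in \<open>auto simp: mem_edges\<close>)
    also have "\<dots> = a * E (\<lambda>s. u1 (x, s)) + b * E (\<lambda>s. u2 (x, s))"
      using ell2_integrable[OF ell2(1) x] ell2_integrable[OF ell2(2) x] by simp
    finally show ?thesis
      using harm x by (simp add: harmonic_iff ell2)
  qed
  then have "harmonic G \<Lambda> \<nu> ?u" by (rule harmonicI[OF ell2_linear[OF ell2]])
  moreover have "?\<omega> e = ?u e + differential G \<Lambda> \<nu> (\<lambda>x. a * f1 x + b * f2 x) e"
    if "e \<in> edges G \<Lambda> \<nu>" for e
    using that by (simp add: f1 f2 differential_def algebra_simps)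
  ultimately show ?thesis
    unfolding is_harmonic_part_def using ell2_linear[OF ell2] by blast
qed

end

section \<open>Covariance forms\<close>

text \<open>Riesz representation for an inner product other than the built-in one. The map
  \<open>J\<close> sends \<open>t\<close> to the vector of its pairings with the basis; it is
  injective by definiteness, hence surjective by dimension.\<close>

lemma inner_product_represents:
  fixes ip :: "'v::euclidean_space \<Rightarrow> 'v \<Rightarrow> real"
  assumes ip: "is_inner_product ip" and \<phi>: "linear \<phi>"
  shows "\<exists>t. \<forall>v. ip v t = \<phi> v"
proof -
  define J where "J t = (\<Sum>b\<in>Basis. ip b t *\<^sub>R b)" for t
  have lin: "linear (ip v)" "linear (\<lambda>v. ip v w)" for v w
    using ip by (auto simp: is_inner_product_def)
  have J: "linear J"
    by (rule linearI)
       (simp_all add: J_def linear_add[OF lin(1)] linear_scale[OF lin(1)] scaleR_add_left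
         sum.distrib scaleR_sum_right)
  have J_inner: "J t \<bullet> b = ip b t" if "b \<in> Basis" for t b
    unfolding J_def using that by simp
  have basis: "ip v t = (\<Sum>b\<in>Basis. (v \<bullet> b) * ip b t)" for v t
  proof -
    have "ip v t = ip (\<Sum>b\<in>Basis. (v \<bullet> b) *\<^sub>R b) t" by (simp add: euclidean_representation)
    also have "\<dots> = (\<Sum>b\<in>Basis. (v \<bullet> b) * ip b t)"
      by (simp add: linear_sum[OF lin(2), of "\<lambda>b. (v \<bullet> b) *\<^sub>R b"] linear_scale[OF lin(2)])
    finally show ?thesis .
  qed
  have "inj J"
    unfolding linear_injective_0[OF J]
  proof (intro allI impI)
    fix t assume "J t = 0"
    then have "ip t t = 0" using J_inner[of _ t] by (subst basis) simp
    then show "t = 0" using ip by (metis is_inner_product_def less_irrefl)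
  qed
  then have "surj J" by (rule linear_inj_imp_surj[OF J])
  then obtain t where t: "J t = (\<Sum>b\<in>Basis. \<phi> b *\<^sub>R b)" by (metis surjD)
  have "ip v t = \<phi> v" for v
  proof -
    have "ip v t = (\<Sum>b\<in>Basis. (v \<bullet> b) * \<phi> b)"
      unfolding basis[of v t] by (intro sum.cong refl) (simp add: J_inner[symmetric] t)
    also have "\<dots> = \<phi> (\<Sum>b\<in>Basis. (v \<bullet> b) *\<^sub>R b)"
      using \<phi> by (simp add: linear_sum linear_scale)
    finally show ?thesis by (simp add: euclidean_representation)
  qed
  then show ?thesis by blast
qed

lemma inner_product_nondegenerate:
  fixes ip :: "'v::real_vector \<Rightarrow> 'v \<Rightarrow> real"
  assumes ip: "is_inner_product ip" and eq: "\<And>v. ip v t = ip v t'"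
  shows "t = t'"
proof (rule ccontr)
  assume "t \<noteq> t'"
  then have "ip (t - t') (t - t') > 0" using ip by (simp add: is_inner_product_def)
  moreover have "linear (ip (t - t'))" using ip by (simp add: is_inner_product_def)
  ultimately show False using eq by (simp add: linear_diff)
qed

text \<open>Discharges the definite description in \<open>covariance\<close>. Vectors are determined
  by their pairings, so linearity and uniqueness of \<open>T\<close> are inherited from the
  form.\<close>

lemma bilinear_form_represented:
  fixes ip :: "'v::euclidean_space \<Rightarrow> 'v \<Rightarrow> real"
  assumes ip: "is_inner_product ip"
    and B: "\<And>w. linear (\<lambda>v. B v w)" "\<And>v. linear (B v)"
  shows "\<exists>!T. linear T \<and> (\<forall>v w. ip v (T w) = B v w)"
proof -
  have "\<forall>w. \<exists>t. \<forall>v. ip v t = B v w"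
    using inner_product_represents[OF ip B(1)] by blast
  then obtain T where T: "\<And>v w. ip v (T w) = B v w" by metis
  have lin: "linear (ip v)" for v using ip by (simp add: is_inner_product_def)
  have "linear T"
  proof (rule linearI)
    show "T (x + y) = T x + T y" for x y
      by (rule inner_product_nondegenerate[OF ip]) (simp add: T linear_add[OF lin] linear_add[OF B(2)])
    show "T (r *\<^sub>R x) = r *\<^sub>R T x" for r x
      by (rule inner_product_nondegenerate[OF ip]) (simp add: T linear_scale[OF lin] linear_scale[OF B(2)])
  qed
  moreover have "T' = T" if "\<forall>v w. ip v (T' w) = B v w" for T'
    by (rule ext, rule inner_product_nondegenerate[OF ip]) (simp add: that T)
  ultimately show ?thesis using T by blast
qed

text \<open>A general euclidean target, and additivity in place of an identification with the
  integer lattice, let the same locale cover \<iota> and \<open>map_prod \<iota> \<iota>\<close>,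
  whose target is a product type.\<close>

locale lattice_quotient = weighted_quotient \<Lambda> G \<nu>
  for \<Lambda> and G (structure) and \<nu> +
  fixes \<Delta> :: "'a set" and \<iota> :: "'a \<Rightarrow> 'v::euclidean_space"
  assumes \<iota>_mult: "\<And>x y. x \<in> \<Lambda> \<Longrightarrow> y \<in> \<Lambda> \<Longrightarrow> \<iota> (x \<otimes> y) = \<iota> x + \<iota> y"
    and reps: "representatives G \<Lambda> \<Delta>"
begin

abbreviation "\<Phi> \<equiv> lattice_part G \<Lambda> \<Delta> \<iota>"
abbreviation "disp x s \<equiv> edge_displacement G \<Lambda> \<Delta> \<iota> (x, s)"

lemma lattice_part_eq:
  assumes l: "l \<in> \<Lambda>" and x: "x \<in> \<Delta>"
  shows "\<Phi> (l \<otimes> x) = \<iota> l"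
proof -
  have xc: "x \<in> carrier G" using x reps by (auto simp: representatives_def)
  have "k = l" if k: "k \<in> \<Lambda>" "y \<in> \<Delta>" "l \<otimes> x = k \<otimes> y" for k y
  proof -
    have yc: "y \<in> carrier G" using k(2) reps by (auto simp: representatives_def)
    have "l \<otimes> x \<in> \<Lambda> #> x" "l \<otimes> x \<in> \<Lambda> #> y" "l \<otimes> x \<in> carrier G"
      using rcosI[OF l subset xc] rcosI[OF k(1) subset yc] k(3) m_closed[OF mem_carrier[OF l] xc] by simp_all
    then have "x = y" using reps x k(2) unfolding representatives_def by metis
    then show ?thesis using k l xc by simp
  qed
  then show ?thesis
    unfolding lattice_part_def using l x by (intro arg_cong[of _ _ \<iota>] the_equality) blast+
qed

lemma carrier_decomp:
  assumes "\<gamma> \<in> carrier G"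
  obtains l x where "l \<in> \<Lambda>" "x \<in> \<Delta>" "\<gamma> = l \<otimes> x"
  using assms reps unfolding representatives_def r_coset_def by blast

lemma lattice_part_mult:
  assumes l: "l \<in> \<Lambda>" and \<gamma>: "\<gamma> \<in> carrier G"
  shows "\<Phi> (l \<otimes> \<gamma>) = \<iota> l + \<Phi> \<gamma>"
proof -
  obtain k x where k: "k \<in> \<Lambda>" "x \<in> \<Delta>" "\<gamma> = k \<otimes> x" using carrier_decomp[OF \<gamma>] .
  then have "x \<in> carrier G" using reps by (auto simp: representatives_def)
  then have "l \<otimes> \<gamma> = (l \<otimes> k) \<otimes> x" using l k by (simp add: m_assoc)
  then show ?thesis using l k by (simp add: lattice_part_eq \<iota>_mult)
qed

text \<open>Another element of the coset differs by a left factor from \<Lambda>, which shifts both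
  lattice parts by the same vector. So the difference is constant on the coset and the definite
  description is justified.\<close>

lemma displacement_eq:
  assumes \<gamma>: "\<gamma> \<in> carrier G" and s: "s \<in> carrier G"
  shows "disp (\<Lambda> #> \<gamma>) s = \<Phi> (\<gamma> \<otimes> s) - \<Phi> \<gamma>"
proof -
  have "\<Phi> (\<gamma>' \<otimes> s) - \<Phi> \<gamma>' = \<Phi> (\<gamma> \<otimes> s) - \<Phi> \<gamma>" if \<gamma>': "\<gamma>' \<in> \<Lambda> #> \<gamma>" for \<gamma>'
  proof -
    obtain l where l: "l \<in> \<Lambda>" "\<gamma>' = l \<otimes> \<gamma>" using \<gamma>' by (auto simp: r_coset_def)
    then have "\<gamma>' \<otimes> s = l \<otimes> (\<gamma> \<otimes> s)" using \<gamma> s by (simp add: m_assoc)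
    then show ?thesis using l \<gamma> s by (simp add: lattice_part_mult)
  qed
  moreover have "\<gamma> \<in> \<Lambda> #> \<gamma>" by (rule rcos_self[OF \<gamma> subgroup_axioms])
  ultimately show ?thesis
    unfolding edge_displacement_def edge_start_def fst_conv snd_conv
    by (intro the_equality) (blast, metis)
qed

lemma vertexE:
  assumes "x \<in> V"
  obtains \<gamma> where "\<gamma> \<in> carrier G" "x = \<Lambda> #> \<gamma>"
  using assms by (auto simp: RCOSETS_def)

text \<open>Telescoping: the second step starts where the first one ends. Antisymmetry under edge
  reversal and the bound by word length both rest on this.\<close>

lemma displacement_cocycle:
  assumes x: "x \<in> V" and s: "s \<in> carrier G" and t: "t \<in> carrier G"
  shows "disp x (s \<otimes> t) = disp x s + disp (x #> s) t"
proof -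
  obtain \<gamma> where \<gamma>: "\<gamma> \<in> carrier G" "x = \<Lambda> #> \<gamma>" using vertexE[OF x] .
  then show ?thesis
    using s t by (simp add: displacement_eq coset_mult_assoc[OF subset] m_assoc)
qed

lemma displacement_one: "x \<in> V \<Longrightarrow> disp x \<one> = 0"
  by (erule vertexE) (simp add: displacement_eq)

lemma displacement_rev:
  assumes "x \<in> V" "s \<in> carrier G"
  shows "disp (x #> s) (inv s) = - disp x s"
  using displacement_cocycle[OF assms inv_closed[OF assms(2)]] displacement_one[OF assms(1)] assms(2)
  by (simp add: eq_neg_iff_add_eq_0 add.commute)

end

text \<open>The moment condition is recorded as square integrability of displacements because this
  form passes directly to the product: displacements there are componentwise and each marginal of
  the coupling is \<mu>.\<close>

locale lattice_covariance = lattice_quotient \<Lambda> G \<nu> \<Delta> \<iota>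
  for \<Lambda> and G (structure) and \<nu> and \<Delta> and \<iota> :: "'a \<Rightarrow> 'v::euclidean_space" +
  fixes ip :: "'v \<Rightarrow> 'v \<Rightarrow> real"
  assumes ip: "is_inner_product ip"
    and square_integrable_displacement:
      "\<And>v x. x \<in> V \<Longrightarrow> L1 (\<lambda>s. (ip v (disp x s))\<^sup>2)"
begin

abbreviation "hat_form v \<equiv> hat G \<Lambda> \<Delta> \<iota> ip \<nu> v"
abbreviation "hpart v \<equiv> harmonic_part G \<Lambda> \<nu> (hat_form v)"
abbreviation "cov v w \<equiv> covariance_form G \<Lambda> \<Delta> \<iota> ip \<nu> v w"

lemma linear_ip: "linear (ip v)" and linear_ip_left: "linear (\<lambda>v. ip v w)"
  using ip by (auto simp: is_inner_product_def)

lemma hat_eq: "(x, s) \<in> edges G \<Lambda> \<nu> \<Longrightarrow> hat_form v (x, s) = ip v (disp x s)"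
  by (simp add: hat_def)

lemma hat_ell2: "hat_form v \<in> ell2_forms G \<Lambda> \<nu>"
proof -
  have "hat_form v (edge_rev G e) = - hat_form v e" if e: "e \<in> edges G \<Lambda> \<nu>" for e
  proof -
    obtain x s where xs: "e = (x, s)" by (cases e)
    then have "x \<in> V" "s \<in> carrier G" using e steps_carrier by (auto simp: mem_edges)
    then show ?thesis
      using e edge_rev_edges[OF e]
      by (simp add: xs hat_eq edge_rev_def displacement_rev linear_neg[OF linear_ip])
  qed
  then have "hat_form v \<in> one_forms G \<Lambda> \<nu>"
    by (simp add: one_forms_def) (simp add: hat_def)
  moreover have "L1 (\<lambda>s. (hat_form v (x, s))\<^sup>2)" if "x \<in> V" for x
    using square_integrable_displacement[OF that, of v]
    by (rule pmf_integrable_cong[THEN iffD1, rotated]) (use that in \<open>auto simp: hat_eq mem_edges\<close>)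
  ultimately show ?thesis by (simp add: ell2_iff)
qed

lemma hat_linear:
  "hat_form (a *\<^sub>R v + b *\<^sub>R w) = (\<lambda>e\<in>edges G \<Lambda> \<nu>. a * hat_form v e + b * hat_form w e)"
  by (rule ext) (simp add: hat_def linear_add[OF linear_ip_left] linear_scale[OF linear_ip_left])

lemma is_harmonic_part_harm: "is_harmonic_part (hat_form v) (hpart v)"
  by (rule is_harmonic_part_harmonic_part[OF hat_ell2])

lemma harm_ell2: "hpart v \<in> ell2_forms G \<Lambda> \<nu>"
  using is_harmonic_part_harm by (simp add: is_harmonic_part_def)

lemma harm_linear:
  "hpart (a *\<^sub>R v + b *\<^sub>R w) = (\<lambda>e\<in>edges G \<Lambda> \<nu>. a * hpart v e + b * hpart w e)"
  unfolding hat_linear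
  by (rule harmonic_part_eqI) (intro is_harmonic_part_linear is_harmonic_part_harm)

lemma harm_mult_integrable: "x \<in> V \<Longrightarrow> L1 (\<lambda>s. hpart v (x, s) * hpart w (x, s))"
  by (intro integrable_pmf_mult ell2_square_integrable harm_ell2)

lemma chi_harm: "chi G \<Lambda> \<nu> (hpart v) = (\<Sum>x\<in>V. E (\<lambda>s. hpart v (x, s))) / N"
  by (rule chi_eq[OF harm_ell2])

lemma covariance_form_eq:
  "cov v w = (\<Sum>x\<in>V. E (\<lambda>s. hpart v (x, s) * hpart w (x, s))) / N
     - chi G \<Lambda> \<nu> (hpart v) * chi G \<Lambda> \<nu> (hpart w)"
  unfolding covariance_form_def Let_def chi_def
  by (subst infsum_edges) (simp_all add: harm_mult_integrable)

lemma covariance_form_commute: "cov v w = cov w v"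
  by (simp add: covariance_form_eq mult.commute)

lemma covariance_form_linear: "cov (a *\<^sub>R v + b *\<^sub>R v') w = a * cov v w + b * cov v' w"
proof -
  let ?u = "hpart (a *\<^sub>R v + b *\<^sub>R v')"
  have u: "?u (x, s) = a * hpart v (x, s) + b * hpart v' (x, s)" if "x \<in> V" "s \<in> set_pmf \<nu>" for x s
    using that by (simp add: harm_linear mem_edges)
  have 1: "E (\<lambda>s. ?u (x, s) * hpart w (x, s)) =
      a * E (\<lambda>s. hpart v (x, s) * hpart w (x, s)) + b * E (\<lambda>s. hpart v' (x, s) * hpart w (x, s))"
    if x: "x \<in> V" for x
  proof -
    have "E (\<lambda>s. ?u (x, s) * hpart w (x, s)) =
        E (\<lambda>s. a * (hpart v (x, s) * hpart w (x, s)) + b * (hpart v' (x, s) * hpart w (x, s)))"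
      by (rule pmf_expectation_cong) (use x in \<open>simp add: u algebra_simps\<close>)
    then show ?thesis using harm_mult_integrable[OF x] by simp
  qed
  have 2: "E (\<lambda>s. ?u (x, s)) = a * E (\<lambda>s. hpart v (x, s)) + b * E (\<lambda>s. hpart v' (x, s))"
    if x: "x \<in> V" for x
  proof -
    have "E (\<lambda>s. ?u (x, s)) = E (\<lambda>s. a * hpart v (x, s) + b * hpart v' (x, s))"
      by (rule pmf_expectation_cong) (use x in \<open>simp add: u\<close>)
    then show ?thesis using ell2_integrable[OF harm_ell2 x] by simp
  qed
  show ?thesis
    unfolding covariance_form_eq chi_harm
    by (simp add: 1 2 sum.distrib flip: sum_distrib_left)
       (simp add: add_divide_distrib algebra_simps)
qed

lemma covariance_form_linear_left: "linear (\<lambda>v. cov v w)"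
proof (rule linearI)
  show "cov (x + y) w = cov x w + cov y w" for x y
    using covariance_form_linear[of 1 x 1 y w] by simp
  show "cov (r *\<^sub>R x) w = r *\<^sub>R cov x w" for r x
    using covariance_form_linear[of r x 0 x w] by simp
qed

lemma covariance_form_linear_right: "linear (\<lambda>w. cov v w)"
  using covariance_form_linear_left[of v] by (simp add: covariance_form_commute[of v])

lemma covariance_spec: "ip v (covariance G \<Lambda> \<Delta> \<iota> ip \<nu> w) = cov v w"
  using theI'[OF bilinear_form_represented[OF ip, of "\<lambda>v w. cov v w"]]
    covariance_form_linear_left covariance_form_linear_right
  unfolding covariance_def by blast

end

section \<open>Displacements and the adjoint action\<close>

text \<open>Ensures that the \<open>LEAST\<close> in \<open>word_length\<close> is attained by an
  actual word.\<close>

lemma (in group) generate_imp_word: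
  assumes S: "S \<subseteq> carrier G" and g: "g \<in> generate G S"
  shows "\<exists>ws. set ws \<subseteq> S \<union> inverses G S \<and> foldr (\<otimes>) ws \<one> = g"
  using g
proof induction
  case one
  show ?case by (rule exI[of _ "[]"]) simp
next
  case (incl h)
  then show ?case using S by (intro exI[of _ "[h]"]) auto
next
  case (inv h)
  then show ?case using S by (intro exI[of _ "[inv h]"]) (auto simp: inverses_def)
next
  case (eng g h)
  obtain us where us: "set us \<subseteq> S \<union> inverses G S" "foldr (\<otimes>) us \<one> = g"
    using eng.IH(1) by blast
  obtain ws where ws: "set ws \<subseteq> S \<union> inverses G S" "foldr (\<otimes>) ws \<one> = h"
    using eng.IH(2) by blast
  have "S \<union> inverses G S \<subseteq> carrier G" using S by (auto simp: inverses_def)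
  then have us_carrier: "set us \<subseteq> carrier G" using us(1) by blast
  have h: "h \<in> carrier G" using eng.hyps generate_in_carrier[OF S] by blast
  have closed: "foldr (\<otimes>) vs \<one> \<in> carrier G" if "set vs \<subseteq> carrier G" for vs
    using that by (induction vs) auto
  have "foldr (\<otimes>) us h = foldr (\<otimes>) us \<one> \<otimes> h"
    using us_carrier
  proof (induction us)
    case (Cons t us)
    then show ?case using h closed[of us] by (simp add: m_assoc)
  qed (simp add: h)
  then have "foldr (\<otimes>) (us @ ws) \<one> = g \<otimes> h" using us ws by simp
  moreover have "set (us @ ws) \<subseteq> S \<union> inverses G S" using us ws by simp
  ultimately show ?case by blast
qed

context lattice_quotient
begin

text \<open>The cocycle identity splits the displacement along a shortest word into one contribution
  per letter. Only finitely many pairs of a coset and a letter occur, so one constant bounds every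
  contribution.\<close>

lemma displacement_linear_growth:
  assumes \<phi>: "linear (\<phi> :: 'v \<Rightarrow> real)"
    and S: "finite S" "S \<subseteq> carrier G" "generate G S = carrier G"
  shows "\<exists>K. \<forall>x\<in>V. \<forall>g\<in>carrier G. \<bar>\<phi> (disp x g)\<bar> \<le> K * real (word_length G S g)"
proof -
  let ?T = "S \<union> inverses G S"
  have T: "finite ?T" "?T \<subseteq> carrier G" using S by (auto simp: inverses_def)
  \<comment> \<open>The sum of all these values dominates each of them and, unlike a maximum, needs
    no nonempty index set.\<close>
  define K where "K = (\<Sum>(x, t)\<in>V \<times> ?T. \<bar>\<phi> (disp x t)\<bar>)"
  have K: "\<bar>\<phi> (disp x t)\<bar> \<le> K" if "x \<in> V" "t \<in> ?T" for x t
    unfolding K_def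
  proof -
    have "(\<lambda>(x, t). \<bar>\<phi> (disp x t)\<bar>) (x, t) \<le> (\<Sum>(x, t)\<in>V \<times> ?T. \<bar>\<phi> (disp x t)\<bar>)"
      by (rule member_le_sum) (use that finite_rcosets T(1) in \<open>auto simp del: Un_iff\<close>)
    then show "\<bar>\<phi> (disp x t)\<bar> \<le> (\<Sum>(x, t)\<in>V \<times> ?T. \<bar>\<phi> (disp x t)\<bar>)" by simp
  qed
  have word: "\<bar>\<phi> (disp x (foldr (\<otimes>) ws \<one>))\<bar> \<le> K * real (length ws) \<and> foldr (\<otimes>) ws \<one> \<in> carrier G"
    if "set ws \<subseteq> ?T" "x \<in> V" for ws x
    using that
  proof (induction ws arbitrary: x)
    case Nil
    then show ?case by (simp add: displacement_one linear_0[OF \<phi>])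
  next
    case (Cons t ws)
    have t: "t \<in> ?T" "t \<in> carrier G" using Cons.prems T by auto
    have ws: "set ws \<subseteq> ?T" using Cons.prems by simp
    let ?g = "foldr (\<otimes>) ws \<one>"
    have g: "?g \<in> carrier G" using Cons.IH[OF ws Cons.prems(2)] by blast
    have "\<bar>\<phi> (disp x (t \<otimes> ?g))\<bar> \<le> \<bar>\<phi> (disp x t)\<bar> + \<bar>\<phi> (disp (x #> t) ?g)\<bar>"
      by (simp add: displacement_cocycle[OF Cons.prems(2) t(2) g] linear_add[OF \<phi>])
    also have "\<dots> \<le> K + K * real (length ws)"
      using K[OF Cons.prems(2) t(1)] Cons.IH[OF ws coset_step[OF Cons.prems(2) t(2)]]
      by (blast intro: add_mono)
    also have "\<dots> = K * real (length (t # ws))" by (simp add: distrib_left)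
    finally show ?case using m_closed[OF t(2) g] by simp
  qed
  have "\<bar>\<phi> (disp x g)\<bar> \<le> K * real (word_length G S g)" if x: "x \<in> V" and g: "g \<in> carrier G" for x g
  proof -
    let ?P = "\<lambda>n. \<exists>ws. length ws = n \<and> set ws \<subseteq> ?T \<and> foldr (\<otimes>) ws \<one> = g"
    have "g \<in> generate G S" using g S(3) by simp
    from generate_imp_word[OF S(2) this] have "\<exists>n. ?P n" by blast
    then have "?P (word_length G S g)" unfolding word_length_def by (rule LeastI_ex)
    then obtain ws where "length ws = word_length G S g" "set ws \<subseteq> ?T" "foldr (\<otimes>) ws \<one> = g" by blast
    then show ?thesis using word[OF _ x, of ws] by simp
  qed
  then show ?thesis by blast
qed

lemma square_integrable_if_finite_second_moment:
  assumes \<phi>: "linear (\<phi> :: 'v \<Rightarrow> real)" and fsm: "finite_second_moment G \<nu>" and x: "x \<in> V"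
  shows "L1 (\<lambda>s. (\<phi> (disp x s))\<^sup>2)"
proof -
  obtain S where S: "finite S" "S \<subseteq> carrier G" "generate G S = carrier G"
    and summable: "(\<lambda>g. (real (word_length G S g))\<^sup>2 * pmf \<nu> g) summable_on carrier G"
    using fsm unfolding finite_second_moment_def by blast
  let ?w = "\<lambda>g. real (word_length G S g)"
  have "(\<lambda>g. (?w g)\<^sup>2 * pmf \<nu> g) summable_on UNIV"
    using summable
  proof (rule summable_on_cong_neutral[THEN iffD1, rotated -1])
    show "(?w g)\<^sup>2 * pmf \<nu> g = 0" if "g \<in> UNIV - carrier G" for g
    proof -
      have "g \<notin> set_pmf \<nu>" using that support by blast
      then show ?thesis by (simp add: pmf_eq_0_set_pmf)
    qed
  qed simp_all
  then have w: "L1 (\<lambda>g. (?w g)\<^sup>2)" unfolding integrable_pmf_iff_summable_on .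
  obtain K where K: "\<forall>x\<in>V. \<forall>g\<in>carrier G. \<bar>\<phi> (disp x g)\<bar> \<le> K * ?w g"
    using displacement_linear_growth[OF \<phi> S] by blast
  show ?thesis
  proof (rule Bochner_Integration.integrable_bound)
    show "L1 (\<lambda>g. K\<^sup>2 * (?w g)\<^sup>2)" using w by (rule integrable_mult_right)
    show "AE s in measure_pmf \<nu>. norm ((\<phi> (disp x s))\<^sup>2) \<le> norm (K\<^sup>2 * (?w s)\<^sup>2)"
    proof (rule AE_pmfI)
      fix s assume "s \<in> set_pmf \<nu>"
      then have s: "s \<in> carrier G" using support by blast
      have "\<bar>\<phi> (disp x s)\<bar>\<^sup>2 \<le> (K * ?w s)\<^sup>2"
        by (rule power_mono) (use K x s in simp_all)
      then show "norm ((\<phi> (disp x s))\<^sup>2) \<le> norm (K\<^sup>2 * (?w s)\<^sup>2)"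
        by (simp add: power_mult_distrib)
    qed
  qed simp
qed

end

text \<open>Additivity gives homogeneity for natural and then integer scalars, and a lattice point
  is an integer combination of unit vectors. Hence the linear map with the same values on the unit
  vectors agrees with \<phi> on the whole lattice. It serves to extend conjugation on \<Lambda> to a
  linear map.\<close>

lemma additive_on_integer_lattice_extends:
  fixes \<phi> :: "real ^ 'm \<Rightarrow> 'b::real_vector"
  assumes add: "\<And>x y. (\<forall>i. x $ i \<in> \<int>) \<Longrightarrow> (\<forall>i. y $ i \<in> \<int>) \<Longrightarrow> \<phi> (x + y) = \<phi> x + \<phi> y"
  shows "\<exists>T. linear T \<and> (\<forall>z. (\<forall>i. z $ i \<in> \<int>) \<longrightarrow> T z = \<phi> z)"
proof -
  define Z where "Z = {v :: real ^ 'm. \<forall>i. v $ i \<in> \<int>}"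
  have addZ: "\<phi> (x + y) = \<phi> x + \<phi> y" if "x \<in> Z" "y \<in> Z" for x y
    using that add by (simp add: Z_def)
  have Z: "0 \<in> Z" "x \<in> Z \<Longrightarrow> y \<in> Z \<Longrightarrow> x + y \<in> Z" "x \<in> Z \<Longrightarrow> - x \<in> Z" for x y
    by (auto simp: Z_def)
  have zero: "\<phi> 0 = 0" using addZ[OF Z(1) Z(1)] by simp
  have uminus: "\<phi> (- x) = - \<phi> x" if "x \<in> Z" for x
    using addZ[OF that Z(3)[OF that]] zero by (simp add: eq_neg_iff_add_eq_0 add.commute)
  have nat: "real n *\<^sub>R x \<in> Z \<and> \<phi> (real n *\<^sub>R x) = real n *\<^sub>R \<phi> x" if "x \<in> Z" for n x
  proof (induction n)
    case (Suc n)
    have "real (Suc n) *\<^sub>R x = x + real n *\<^sub>R x" by (simp add: scaleR_add_left)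
    with Suc show ?case using that by (simp add: Z addZ scaleR_add_left)
  qed (simp add: zero Z)
  have int: "of_int k *\<^sub>R x \<in> Z \<and> \<phi> (of_int k *\<^sub>R x) = of_int k *\<^sub>R \<phi> x" if "x \<in> Z" for k x
  proof (cases k)
    case (nonneg n)
    then show ?thesis using nat[OF that] by simp
  next
    case (neg n)
    then have k: "(of_int k :: real) = - real (Suc n)" by simp
    show ?thesis
      unfolding k scaleR_minus_left
      using nat[OF that, of "Suc n"] Z(3)[of "real (Suc n) *\<^sub>R x"] uminus[of "real (Suc n) *\<^sub>R x"]
      by (simp del: of_nat_Suc)
  qed
  have axis: "axis i 1 \<in> Z" for i by (auto simp: Z_def axis_def)
  have sum: "(\<Sum>i\<in>A. z $ i *\<^sub>R axis i 1) \<in> Z \<and>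
      \<phi> (\<Sum>i\<in>A. z $ i *\<^sub>R axis i 1) = (\<Sum>i\<in>A. z $ i *\<^sub>R \<phi> (axis i 1))" if z: "z \<in> Z" for z A
  proof (induction A rule: infinite_finite_induct)
    case (insert i A)
    from z obtain k where k: "z $ i = of_int k" unfolding Z_def Ints_def by auto
    have i: "z $ i *\<^sub>R axis i 1 \<in> Z" "\<phi> (z $ i *\<^sub>R axis i 1) = z $ i *\<^sub>R \<phi> (axis i 1)"
      using int[OF axis, of k i] by (simp_all only: k)
    show ?case
      using insert.hyps insert.IH Z(2)[OF i(1)] addZ[OF i(1)] i(2) by simp
  qed (simp_all add: zero Z)
  define T where "T v = (\<Sum>i\<in>UNIV. v $ i *\<^sub>R \<phi> (axis i 1))" for v
  have "linear T"
    by (rule linearI) (simp_all add: T_def scaleR_add_left sum.distrib scaleR_sum_right)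
  moreover have "T z = \<phi> z" if "z \<in> Z" for z
    using sum[OF that, of UNIV] basis_expansion[of z] by (simp add: T_def scalar_mult_eq_scaleR)
  ultimately show ?thesis unfolding Z_def by auto
qed

section \<open>The adjoint action of the quotient on the ambient space of the lattice\<close>

locale integer_lattice = normal \<Lambda> G
  for \<Lambda> and G (structure) +
  fixes \<iota> :: "'a \<Rightarrow> real ^ 'm"
  assumes lattice: "identifies_with_Zm G \<Lambda> \<iota>"
begin

lemma iota_mult: "x \<in> \<Lambda> \<Longrightarrow> y \<in> \<Lambda> \<Longrightarrow> \<iota> (x \<otimes> y) = \<iota> x + \<iota> y"
  using lattice by (simp add: identifies_with_Zm_def)

lemma iota_bij: "bij_betw \<iota> \<Lambda> {v. \<forall>i. v $ i \<in> \<int>}"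
  using lattice by (simp add: identifies_with_Zm_def)

lemma lattice_commute:
  assumes "x \<in> \<Lambda>" "y \<in> \<Lambda>"
  shows "x \<otimes> y = y \<otimes> x"
proof (rule inj_onD[OF bij_betw_imp_inj_on[OF iota_bij]])
  show "\<iota> (x \<otimes> y) = \<iota> (y \<otimes> x)" using assms by (simp add: iota_mult)
qed (use assms in simp_all)

lemma conj_closed: "x \<in> carrier G \<Longrightarrow> l \<in> \<Lambda> \<Longrightarrow> x \<otimes> l \<otimes> inv x \<in> \<Lambda>"
  by (rule inv_op_closed2)

text \<open>The image of \<Lambda> contains the standard basis.\<close>

lemma linear_eq_on_lattice:
  fixes S T :: "real ^ 'm \<Rightarrow> 'c::real_vector"
  assumes "linear S" "linear T" "\<And>l. l \<in> \<Lambda> \<Longrightarrow> S (\<iota> l) = T (\<iota> l)"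
  shows "S = T"
proof (rule linear_eq_stdbasis[OF assms(1,2)])
  fix b :: "real ^ 'm" assume "b \<in> Basis"
  then have "b \<in> \<iota> ` \<Lambda>"
    using bij_betw_imp_surj_on[OF iota_bij] by (auto simp: Basis_vec_def axis_def)
  then show "S b = T b" using assms(3) by auto
qed

lemma conjugation_extends:
  assumes x: "x \<in> carrier G"
  shows "\<exists>T. linear T \<and> (\<forall>l\<in>\<Lambda>. T (\<iota> l) = \<iota> (x \<otimes> l \<otimes> inv x))"
proof -
  let ?inv = "the_inv_into \<Lambda> \<iota>"
  let ?\<phi> = "\<lambda>z. \<iota> (x \<otimes> ?inv z \<otimes> inv x)"
  have inv_iota: "?inv (\<iota> l) = l" if "l \<in> \<Lambda>" for l
    by (rule the_inv_into_f_f[OF bij_betw_imp_inj_on[OF iota_bij] that])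
  have ex: "\<exists>l\<in>\<Lambda>. z = \<iota> l" if "\<forall>i. z $ i \<in> \<int>" for z
    using bij_betw_imp_surj_on[OF iota_bij] that by blast
  have "?\<phi> (y + z) = ?\<phi> y + ?\<phi> z" if yz: "\<forall>i. y $ i \<in> \<int>" "\<forall>i. z $ i \<in> \<int>" for y z
  proof -
    obtain k where k: "k \<in> \<Lambda>" "y = \<iota> k" using ex[OF yz(1)] by blast
    obtain l where l: "l \<in> \<Lambda>" "z = \<iota> l" using ex[OF yz(2)] by blast
    have kl: "k \<in> carrier G" "l \<in> carrier G" using k l by auto
    have "inv x \<otimes> (x \<otimes> (l \<otimes> inv x)) = l \<otimes> inv x"
      using x kl m_assoc[of "inv x" x "l \<otimes> inv x", symmetric] by simp
    then have "x \<otimes> (k \<otimes> l) \<otimes> inv x = (x \<otimes> k \<otimes> inv x) \<otimes> (x \<otimes> l \<otimes> inv x)"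
      using x kl by (simp add: m_assoc)
    moreover have "y + z = \<iota> (k \<otimes> l)" using k l by (simp add: iota_mult)
    ultimately have "?\<phi> (y + z) = \<iota> ((x \<otimes> k \<otimes> inv x) \<otimes> (x \<otimes> l \<otimes> inv x))"
      using k(1) l(1) by (simp add: inv_iota)
    also have "\<dots> = ?\<phi> y + ?\<phi> z"
      using k l x by (simp add: inv_iota iota_mult conj_closed)
    finally show ?thesis .
  qed
  from additive_on_integer_lattice_extends[OF this] obtain T where
    T: "linear T" "\<forall>z. (\<forall>i. z $ i \<in> \<int>) \<longrightarrow> T z = ?\<phi> z" by blast
  have "T (\<iota> l) = \<iota> (x \<otimes> l \<otimes> inv x)" if l: "l \<in> \<Lambda>" for l
  proof -
    have "\<forall>i. \<iota> l $ i \<in> \<int>" using bij_betw_apply[OF iota_bij l] by simp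
    then have "T (\<iota> l) = ?\<phi> (\<iota> l)" using T(2) by blast
    then show ?thesis by (simp only: inv_iota[OF l])
  qed
  with T(1) show ?thesis by blast
qed

text \<open>The extra factor \<open>k\<close> lies in \<Lambda> and so does the conjugate of
  \<open>l\<close>; they commute because \<Lambda> is abelian. Hence conjugation depends on the
  coset only.\<close>

lemma conjugation_cong:
  assumes x: "x \<in> carrier G" and y: "y \<in> \<Lambda> #> x" and l: "l \<in> \<Lambda>"
  shows "y \<otimes> l \<otimes> inv y = x \<otimes> l \<otimes> inv x"
proof -
  obtain k where k: "k \<in> \<Lambda>" "y = k \<otimes> x" using y by (auto simp: r_coset_def)
  let ?c = "x \<otimes> l \<otimes> inv x"
  have c: "?c \<in> \<Lambda>" by (rule conj_closed[OF x l])
  have "y \<otimes> l \<otimes> inv y = k \<otimes> ?c \<otimes> inv k"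
    using k x l by (simp add: m_assoc inv_mult_group)
  also have "\<dots> = ?c \<otimes> k \<otimes> inv k" using lattice_commute[OF k(1) c] by simp
  also have "\<dots> = ?c \<otimes> (k \<otimes> inv k)"
    using k(1) c mem_carrier by (intro m_assoc) auto
  also have "\<dots> = ?c" using k(1) c mem_carrier by simp
  finally show ?thesis .
qed

lemma
  assumes x: "x \<in> carrier G"
  shows linear_Ad: "linear (Ad G \<Lambda> \<iota> (\<Lambda> #> x))"
    and Ad_iota: "l \<in> \<Lambda> \<Longrightarrow> Ad G \<Lambda> \<iota> (\<Lambda> #> x) (\<iota> l) = \<iota> (x \<otimes> l \<otimes> inv x)"
proof -
  let ?P = "\<lambda>T. linear T \<and> (\<forall>y\<in>\<Lambda> #> x. \<forall>l\<in>\<Lambda>. T (\<iota> l) = \<iota> (y \<otimes> l \<otimes> inv y))"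
  have x_mem: "x \<in> \<Lambda> #> x" by (rule rcos_self[OF x subgroup_axioms])
  obtain T where T: "linear T" "\<forall>l\<in>\<Lambda>. T (\<iota> l) = \<iota> (x \<otimes> l \<otimes> inv x)"
    using conjugation_extends[OF x] by blast
  have "?P T"
  proof (intro conjI ballI T(1))
    fix y l assume yl: "y \<in> \<Lambda> #> x" "l \<in> \<Lambda>"
    show "T (\<iota> l) = \<iota> (y \<otimes> l \<otimes> inv y)"
      unfolding conjugation_cong[OF x yl] using T(2) yl(2) by blast
  qed
  moreover have "S = T" if S: "?P S" for S
  proof (rule linear_eq_on_lattice)
    fix l assume l: "l \<in> \<Lambda>"
    have "S (\<iota> l) = \<iota> (x \<otimes> l \<otimes> inv x)" using S x_mem l by blast
    also have "\<dots> = T (\<iota> l)" using T(2) l by simp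
    finally show "S (\<iota> l) = T (\<iota> l)" .
  qed (use S T(1) in blast)+
  ultimately have "?P (Ad G \<Lambda> \<iota> (\<Lambda> #> x))"
    unfolding Ad_def by (rule theI)
  then show "linear (Ad G \<Lambda> \<iota> (\<Lambda> #> x))"
    and "l \<in> \<Lambda> \<Longrightarrow> Ad G \<Lambda> \<iota> (\<Lambda> #> x) (\<iota> l) = \<iota> (x \<otimes> l \<otimes> inv x)"
    using x_mem by blast+
qed

lemma Ad_mult:
  assumes x: "x \<in> carrier G" and y: "y \<in> carrier G"
  shows "Ad G \<Lambda> \<iota> (\<Lambda> #> (x \<otimes> y)) v = Ad G \<Lambda> \<iota> (\<Lambda> #> x) (Ad G \<Lambda> \<iota> (\<Lambda> #> y) v)"
proof -
  have "Ad G \<Lambda> \<iota> (\<Lambda> #> (x \<otimes> y)) = Ad G \<Lambda> \<iota> (\<Lambda> #> x) \<circ> Ad G \<Lambda> \<iota> (\<Lambda> #> y)"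
  proof (rule linear_eq_on_lattice)
    show "linear (Ad G \<Lambda> \<iota> (\<Lambda> #> (x \<otimes> y)))" using x y by (simp add: linear_Ad)
    show "linear (Ad G \<Lambda> \<iota> (\<Lambda> #> x) \<circ> Ad G \<Lambda> \<iota> (\<Lambda> #> y))"
      using x y by (intro linear_compose linear_Ad)
    fix l assume l: "l \<in> \<Lambda>"
    then have "x \<otimes> y \<otimes> l \<otimes> inv (x \<otimes> y) = x \<otimes> (y \<otimes> l \<otimes> inv y) \<otimes> inv x"
      using x y by (simp add: m_assoc inv_mult_group)
    then show "Ad G \<Lambda> \<iota> (\<Lambda> #> (x \<otimes> y)) (\<iota> l) = (Ad G \<Lambda> \<iota> (\<Lambda> #> x) \<circ> Ad G \<Lambda> \<iota> (\<Lambda> #> y)) (\<iota> l)"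
      using x y l by (simp add: Ad_iota conj_closed)
  qed
  then show ?thesis by simp
qed

text \<open>The transfer averages over the quotient group; applying the action of \<open>C\<close>
  reindexes the sum by left multiplication with \<open>C\<close>, a bijection of the cosets.\<close>

lemma Ad_normalized_transfer:
  assumes C: "C \<in> rcosets \<Lambda>" and fin: "finite (rcosets \<Lambda>)"
  shows "Ad G \<Lambda> \<iota> C (normalized_transfer G \<Lambda> \<iota> v) = normalized_transfer G \<Lambda> \<iota> v"
proof -
  obtain x where x: "x \<in> carrier G" "C = \<Lambda> #> x" using C by (auto simp: RCOSETS_def)
  have ex: "\<exists>y\<in>carrier G. D = \<Lambda> #> y" if "D \<in> rcosets \<Lambda>" for D
    using that by (auto simp: RCOSETS_def)
  have closed: "(\<Lambda> #> a) <#> D \<in> rcosets \<Lambda>" if "a \<in> carrier G" "D \<in> rcosets \<Lambda>" for a D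
    using ex[OF that(2)] that(1) by (auto simp: rcos_sum intro!: rcosetsI subset)
  have cancel: "(\<Lambda> #> a) <#> ((\<Lambda> #> b) <#> D) = D"
    if "a \<in> carrier G" "b \<in> carrier G" "a \<otimes> b = \<one>" and D: "D \<in> rcosets \<Lambda>" for a b D
  proof -
    obtain y where y: "y \<in> carrier G" "D = \<Lambda> #> y" using ex[OF D] by blast
    have "a \<otimes> (b \<otimes> y) = y" using that y(1) by (simp flip: m_assoc)
    then show ?thesis using that(1,2) y by (simp add: rcos_sum)
  qed
  have bij: "bij_betw (\<lambda>D. (\<Lambda> #> x) <#> D) (rcosets \<Lambda>) (rcosets \<Lambda>)"
    by (rule bij_betwI[where g = "\<lambda>D. (\<Lambda> #> inv x) <#> D"])
       (simp_all add: closed cancel x(1))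
  have "(\<Sum>D\<in>rcosets \<Lambda>. Ad G \<Lambda> \<iota> C (Ad G \<Lambda> \<iota> D v)) =
      (\<Sum>D\<in>rcosets \<Lambda>. Ad G \<Lambda> \<iota> ((\<Lambda> #> x) <#> D) v)"
  proof (rule sum.cong[OF refl])
    fix D assume "D \<in> rcosets \<Lambda>"
    then obtain y where "y \<in> carrier G" "D = \<Lambda> #> y" using ex by blast
    then show "Ad G \<Lambda> \<iota> C (Ad G \<Lambda> \<iota> D v) = Ad G \<Lambda> \<iota> ((\<Lambda> #> x) <#> D) v"
      using x by (simp add: rcos_sum Ad_mult)
  qed
  also have "\<dots> = (\<Sum>D\<in>rcosets \<Lambda>. Ad G \<Lambda> \<iota> D v)"
    by (rule sum.reindex_bij_betw[OF bij])
  finally have "(\<Sum>D\<in>rcosets \<Lambda>. Ad G \<Lambda> \<iota> C (Ad G \<Lambda> \<iota> D v)) = (\<Sum>D\<in>rcosets \<Lambda>. Ad G \<Lambda> \<iota> D v)" .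
  moreover have "linear (Ad G \<Lambda> \<iota> C)" unfolding x(2) by (rule linear_Ad[OF x(1)])
  ultimately show ?thesis
    unfolding normalized_transfer_def by (simp only: linear_scale linear_sum)
qed

end

section \<open>Pullback to the product\<close>

text \<open>A homomorphism that carries lattice onto lattice and step law to step law maps one
  weighted quotient graph to the other. The instances are the two coordinate projections of the
  product group.\<close>

locale quotient_morphism =
  Q: weighted_quotient \<Lambda>' G' \<nu>' + W: weighted_quotient \<Lambda> G \<nu>
  for \<Lambda>' :: "'c set" and G' :: "('c, 'd) monoid_scheme" and \<nu>'
    and \<Lambda> :: "'a set" and G :: "('a, 'b) monoid_scheme" and \<nu> +
  fixes p :: "'c \<Rightarrow> 'a"
  assumes hom: "p \<in> hom G' G"
    and image_lattice: "p ` \<Lambda>' = \<Lambda>"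
    and image_measure: "map_pmf p \<nu>' = \<nu>"
begin

definition pullback :: "('a edge \<Rightarrow> real) \<Rightarrow> 'c edge \<Rightarrow> real" where
  "pullback \<omega> = (\<lambda>e\<in>edges G' \<Lambda>' \<nu>'. \<omega> (p ` fst e, p (snd e)))"

lemma hom_mult: "x \<in> carrier G' \<Longrightarrow> y \<in> carrier G' \<Longrightarrow> p (x \<otimes>\<^bsub>G'\<^esub> y) = p x \<otimes>\<^bsub>G\<^esub> p y"
  using hom by (rule hom_mult)

lemma hom_closed: "x \<in> carrier G' \<Longrightarrow> p x \<in> carrier G"
  using hom by (rule hom_in_carrier)

lemma hom_inv: "x \<in> carrier G' \<Longrightarrow> p (inv\<^bsub>G'\<^esub> x) = inv\<^bsub>G\<^esub> p x"
  using hom Q.group_axioms W.group_axioms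
  by (intro group_hom.hom_inv) (simp add: group_hom_def group_hom_axioms_def)

lemma image_r_coset:
  assumes "M \<subseteq> carrier G'" "z \<in> carrier G'"
  shows "p ` (M #>\<^bsub>G'\<^esub> z) = (p ` M) #>\<^bsub>G\<^esub> p z"
proof -
  have "p (h \<otimes>\<^bsub>G'\<^esub> z) = p h \<otimes>\<^bsub>G\<^esub> p z" if "h \<in> M" for h
    using that assms by (intro hom_mult) auto
  then show ?thesis unfolding r_coset_def by force
qed

lemma image_vertex:
  assumes "C \<in> Q.V"
  shows "p ` C \<in> W.V"
proof -
  obtain z where z: "z \<in> carrier G'" "C = \<Lambda>' #>\<^bsub>G'\<^esub> z" using assms by (auto simp: RCOSETS_def)
  then show ?thesis
    by (simp add: image_r_coset[OF Q.subset] image_lattice hom_closed W.rcosetsI[OF W.subset])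
qed

lemma image_coset_step:
  "C \<in> Q.V \<Longrightarrow> z \<in> carrier G' \<Longrightarrow> p ` (C #>\<^bsub>G'\<^esub> z) = (p ` C) #>\<^bsub>G\<^esub> p z"
  by (rule image_r_coset[OF Q.vertex_carrier])

lemma image_support: "z \<in> set_pmf \<nu>' \<Longrightarrow> p z \<in> set_pmf \<nu>"
  using image_measure by (metis imageI pmf.set_map)

lemma image_steps:
  assumes "z \<in> Q.steps"
  shows "p z \<in> W.steps"
proof (cases "z \<in> set_pmf \<nu>'")
  case True
  then show ?thesis using image_support by blast
next
  case False
  then obtain y where y: "y \<in> set_pmf \<nu>'" "z = inv\<^bsub>G'\<^esub> y"
    using assms unfolding inverses_def by blast
  then have "p z = inv\<^bsub>G\<^esub> p y" using Q.support by (intro trans[OF _ hom_inv]) auto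
  then show ?thesis using image_support[OF y(1)] unfolding inverses_def by blast
qed

lemma image_edge:
  assumes "e \<in> edges G' \<Lambda>' \<nu>'"
  shows "(p ` fst e, p (snd e)) \<in> edges G \<Lambda> \<nu>"
proof -
  have "fst e \<in> Q.V" "snd e \<in> Q.steps" using assms by (auto simp: edges_def)
  then show ?thesis unfolding W.mem_edges using image_vertex image_steps by blast
qed

lemma pullback_eq: "(C, z) \<in> edges G' \<Lambda>' \<nu>' \<Longrightarrow> pullback \<omega> (C, z) = \<omega> (p ` C, p z)"
  by (simp add: pullback_def)

lemma integrable_comp: "Q.L1 (\<lambda>z. h (p z)) \<longleftrightarrow> W.L1 h"
  using integrable_map_pmf_eq[of p \<nu>' h] unfolding image_measure by simp

lemma expectation_comp: "Q.E (\<lambda>z. h (p z)) = W.E h"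
  using integral_map_pmf[of p \<nu>' h] unfolding image_measure by simp

lemma edge_support: "C \<in> Q.V \<Longrightarrow> z \<in> set_pmf \<nu>' \<Longrightarrow> (C, z) \<in> edges G' \<Lambda>' \<nu>'"
  by (simp add: Q.mem_edges)

lemma expectation_pullback:
  "C \<in> Q.V \<Longrightarrow> Q.E (\<lambda>z. pullback \<omega> (C, z)) = W.E (\<lambda>s. \<omega> (p ` C, s))"
  using expectation_comp[of "\<lambda>s. \<omega> (p ` C, s)"] pmf_expectation_cong[of \<nu>'
      "\<lambda>z. pullback \<omega> (C, z)" "\<lambda>z. \<omega> (p ` C, p z)"]
  by (simp add: pullback_eq edge_support)

lemma pullback_ell2:
  assumes \<omega>: "\<omega> \<in> ell2_forms G \<Lambda> \<nu>"
  shows "pullback \<omega> \<in> ell2_forms G' \<Lambda>' \<nu>'"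
proof -
  have "pullback \<omega> (edge_rev G' e) = - pullback \<omega> e" if e: "e \<in> edges G' \<Lambda>' \<nu>'" for e
  proof -
    have e': "fst e \<in> Q.V" "snd e \<in> carrier G'"
      using e Q.steps_carrier by (auto simp: edges_def)
    have "pullback \<omega> (edge_rev G' e) = \<omega> (edge_rev G (p ` fst e, p (snd e)))"
      using Q.edge_rev_edges[OF e] e'
      by (simp add: pullback_def edge_rev_def image_coset_step hom_inv)
    also have "\<dots> = - \<omega> (p ` fst e, p (snd e))"
      using \<omega> image_edge[OF e] by (simp add: W.ell2_iff one_forms_def)
    finally show ?thesis using e by (simp add: pullback_def)
  qed
  then have "pullback \<omega> \<in> one_forms G' \<Lambda>' \<nu>'"
    by (simp add: one_forms_def) (simp add: pullback_def)
  moreover have "Q.L1 (\<lambda>z. (pullback \<omega> (C, z))\<^sup>2)" if C: "C \<in> Q.V" for C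
  proof -
    have "Q.L1 (\<lambda>z. (\<omega> (p ` C, p z))\<^sup>2)"
      using integrable_comp[of "\<lambda>s. (\<omega> (p ` C, s))\<^sup>2"] W.ell2_square_integrable[OF \<omega> image_vertex[OF C]]
      by simp
    then show ?thesis
      by (rule pmf_integrable_cong[THEN iffD1, rotated]) (simp add: pullback_eq edge_support C)
  qed
  ultimately show ?thesis by (simp add: Q.ell2_iff)
qed

text \<open>The mean of a pulled-back form at \<open>C\<close> is the mean of the original at the
  image of \<open>C\<close>, because \<open>p\<close> pushes the one step law to the other; so
  constancy of vertex means is preserved. Composing the old potential with the map on cosets gives
  the new one.\<close>

lemma is_harmonic_part_pullback:
  assumes u: "W.is_harmonic_part \<omega> u"
  shows "Q.is_harmonic_part (pullback \<omega>) (pullback u)"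
proof -
  have ell2: "u \<in> ell2_forms G \<Lambda> \<nu>" and harm: "harmonic G \<Lambda> \<nu> u"
    using u by (auto simp: W.is_harmonic_part_def)
  obtain f where f: "\<forall>e\<in>edges G \<Lambda> \<nu>. \<omega> e = u e + differential G \<Lambda> \<nu> f e"
    using u unfolding W.is_harmonic_part_def by blast
  have "Q.E (\<lambda>z. pullback u (C, z)) = chi G \<Lambda> \<nu> u" if "C \<in> Q.V" for C
    using harm image_vertex[OF that]
    by (simp add: expectation_pullback[OF that] W.harmonic_iff[OF ell2])
  then have "harmonic G' \<Lambda>' \<nu>' (pullback u)"
    by (rule Q.harmonicI[OF pullback_ell2[OF ell2]])
  moreover have "pullback \<omega> e = pullback u e + differential G' \<Lambda>' \<nu>' (\<lambda>C. f (p ` C)) e"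
    if e: "e \<in> edges G' \<Lambda>' \<nu>'" for e
  proof -
    have e': "fst e \<in> Q.V" "snd e \<in> carrier G'"
      using e Q.steps_carrier by (auto simp: edges_def)
    show ?thesis
      using f[rule_format, OF image_edge[OF e]] e image_edge[OF e] e'
      by (simp add: pullback_def differential_def edge_end_def edge_start_def image_coset_step)
  qed
  ultimately show ?thesis
    unfolding Q.is_harmonic_part_def using pullback_ell2[OF ell2] by blast
qed

end

section \<open>The coupled walk on the product graph\<close>

locale diagonal_coupling = lattice_covariance \<Lambda> G \<mu> \<Delta> \<iota> ip
  for \<Lambda> and G (structure) and \<mu> and \<Delta> and \<iota> :: "'a \<Rightarrow> 'v::euclidean_space" and ip +
  fixes \<rho> :: real
  assumes rho: "0 \<le> \<rho>" "\<rho> \<le> 1"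
    and pi_generated: "semigroup_generated (G \<times>\<times> G) (set_pmf (pi_rho \<rho> \<mu>)) = carrier (G \<times>\<times> G)"
begin

abbreviation "\<pi> \<equiv> pi_rho \<rho> \<mu>"
abbreviation "G2 \<equiv> G \<times>\<times> G"
abbreviation "V2 \<equiv> rcosets\<^bsub>G2\<^esub> (\<Lambda> \<times> \<Lambda>)"

lemma r_coset_Times: "(A \<times> B) #>\<^bsub>G2\<^esub> (s, t) = (A #> s) \<times> (B #> t)"
  by (auto simp: r_coset_def DirProd_def)

lemma vertices_Times: "V2 = (\<lambda>(A, B). A \<times> B) ` (V \<times> V)"
proof
  show "V2 \<subseteq> (\<lambda>(A, B). A \<times> B) ` (V \<times> V)"
  proof
    fix C assume "C \<in> V2"
    then obtain a b where "a \<in> carrier G" "b \<in> carrier G" "C = (\<Lambda> \<times> \<Lambda>) #>\<^bsub>G2\<^esub> (a, b)"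
      by (auto simp: RCOSETS_def DirProd_def)
    then show "C \<in> (\<lambda>(A, B). A \<times> B) ` (V \<times> V)"
      by (auto simp: r_coset_Times intro!: rcosetsI subset)
  qed
next
  show "(\<lambda>(A, B). A \<times> B) ` (V \<times> V) \<subseteq> V2"
  proof
    fix C assume "C \<in> (\<lambda>(A, B). A \<times> B) ` (V \<times> V)"
    then obtain A B where AB: "A \<in> V" "B \<in> V" "C = A \<times> B" by blast
    obtain a where a: "a \<in> carrier G" "A = \<Lambda> #> a" using vertexE[OF AB(1)] .
    obtain b where b: "b \<in> carrier G" "B = \<Lambda> #> b" using vertexE[OF AB(2)] .
    have "C = (\<Lambda> \<times> \<Lambda>) #>\<^bsub>G2\<^esub> (a, b)" "(a, b) \<in> carrier G2"
      using a b AB(3) by (simp_all add: r_coset_Times)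
    then show "C \<in> V2" unfolding RCOSETS_def by blast
  qed
qed

lemma vertex_nonempty: "A \<in> V \<Longrightarrow> A \<noteq> {}"
  by (erule vertexE) (use rcos_self[OF _ subgroup_axioms] in auto)

text \<open>A product set determines its factors only when both are nonempty, which cosets
  are.\<close>

lemma inj_on_Times: "inj_on (\<lambda>(A, B). A \<times> B) (V \<times> V)"
  using vertex_nonempty by (auto simp: inj_on_def times_eq_iff)

lemma card_V2: "card V2 = card V * card V"
  unfolding vertices_Times by (simp add: card_image[OF inj_on_Times] card_cartesian_product)

lemma sum_V2: "(\<Sum>C\<in>V2. f C) = (\<Sum>A\<in>V. \<Sum>B\<in>V. f (A \<times> B))"
  unfolding vertices_Times sum.reindex[OF inj_on_Times] sum.cartesian_product
  by (simp add: o_def case_prod_unfold)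

lemma V2E:
  assumes "C \<in> V2"
  obtains A B where "A \<in> V" "B \<in> V" "C = A \<times> B"
  using assms unfolding vertices_Times by blast

sublocale P: weighted_quotient "\<Lambda> \<times> \<Lambda>" G2 \<pi>
proof -
  have "normal (\<Lambda> \<times> \<Lambda>) G2"
    by (rule DirProd_normal[OF group_axioms normal_axioms normal_axioms])
  moreover have "set_pmf \<pi> \<subseteq> carrier G2"
    unfolding pi_generated[symmetric] by (blast intro: semigroup_generated.base)
  moreover have "finite V2" unfolding vertices_Times using finite_rcosets by simp
  ultimately show "weighted_quotient (\<Lambda> \<times> \<Lambda>) G2 \<pi>"
    using pi_generated unfolding weighted_quotient_def weighted_quotient_axioms_def by blast
qed

sublocale P: lattice_quotient "\<Lambda> \<times> \<Lambda>" G2 \<pi> "\<Delta> \<times> \<Delta>" "map_prod \<iota> \<iota>"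
proof unfold_locales
  fix x y assume "x \<in> \<Lambda> \<times> \<Lambda>" "y \<in> \<Lambda> \<times> \<Lambda>"
  then show "map_prod \<iota> \<iota> (x \<otimes>\<^bsub>G2\<^esub> y) = map_prod \<iota> \<iota> x + map_prod \<iota> \<iota> y"
    by (cases x; cases y) (simp add: \<iota>_mult)
next
  have reps_subset: "\<Delta> \<subseteq> carrier G" and one_rep: "\<one> \<in> \<Delta>"
    using reps unfolding representatives_def by blast+
  have unique_rep: "\<exists>!x. x \<in> \<Delta> \<and> \<gamma> \<in> \<Lambda> #> x" if "\<gamma> \<in> carrier G" for \<gamma>
    using reps that unfolding representatives_def by (elim conjE) (rule bspec)
  show "representatives G2 (\<Lambda> \<times> \<Lambda>) (\<Delta> \<times> \<Delta>)"
    unfolding representatives_def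
  proof (intro conjI ballI)
    show "\<Delta> \<times> \<Delta> \<subseteq> carrier G2" "\<one>\<^bsub>G2\<^esub> \<in> \<Delta> \<times> \<Delta>"
      using reps_subset one_rep by (auto simp: DirProd_def)
    fix z assume "z \<in> carrier G2"
    then obtain a b where ab: "z = (a, b)" "a \<in> carrier G" "b \<in> carrier G"
      by (auto simp: DirProd_def)
    note ex_a = unique_rep[OF ab(2)] and ex_b = unique_rep[OF ab(3)]
    obtain x where x: "x \<in> \<Delta> \<and> a \<in> \<Lambda> #> x" using ex1_implies_ex[OF ex_a] by (rule exE)
    obtain y where y: "y \<in> \<Delta> \<and> b \<in> \<Lambda> #> y" using ex1_implies_ex[OF ex_b] by (rule exE)
    show "\<exists>!w. w \<in> \<Delta> \<times> \<Delta> \<and> z \<in> (\<Lambda> \<times> \<Lambda>) #>\<^bsub>G2\<^esub> w"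
    proof (rule ex1I[of _ "(x, y)"])
      show "(x, y) \<in> \<Delta> \<times> \<Delta> \<and> z \<in> (\<Lambda> \<times> \<Lambda>) #>\<^bsub>G2\<^esub> (x, y)"
        using x y by (simp add: ab(1) r_coset_Times)
      fix w assume w: "w \<in> \<Delta> \<times> \<Delta> \<and> z \<in> (\<Lambda> \<times> \<Lambda>) #>\<^bsub>G2\<^esub> w"
      obtain x' y' where xy: "w = (x', y')" by (cases w)
      have "x' \<in> \<Delta> \<and> a \<in> \<Lambda> #> x'" "y' \<in> \<Delta> \<and> b \<in> \<Lambda> #> y'"
        using w by (simp_all add: xy ab(1) r_coset_Times)
      then have "x' = x" "y' = y"
        using ex_a ex_b x y by blast+
      then show "w = (x, y)" by (simp add: xy)
    qed
  qed
qed

lemma lattice_part_Times: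
  assumes "a \<in> carrier G" "b \<in> carrier G"
  shows "P.\<Phi> (a, b) = (\<Phi> a, \<Phi> b)"
proof -
  obtain k x where k: "k \<in> \<Lambda>" "x \<in> \<Delta>" "a = k \<otimes> x" using carrier_decomp[OF assms(1)] .
  obtain l y where l: "l \<in> \<Lambda>" "y \<in> \<Delta>" "b = l \<otimes> y" using carrier_decomp[OF assms(2)] .
  show ?thesis
    using P.lattice_part_eq[of "(k, l)" "(x, y)"] k l by (simp add: lattice_part_eq)
qed

lemma displacement_Times:
  assumes "A \<in> V" "B \<in> V" "s \<in> carrier G" "t \<in> carrier G"
  shows "P.disp (A \<times> B) (s, t) = (disp A s, disp B t)"
proof -
  obtain a where a: "a \<in> carrier G" "A = \<Lambda> #> a" using vertexE[OF assms(1)] .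
  obtain b where b: "b \<in> carrier G" "B = \<Lambda> #> b" using vertexE[OF assms(2)] .
  have "A \<times> B = (\<Lambda> \<times> \<Lambda>) #>\<^bsub>G2\<^esub> (a, b)" by (simp add: a b r_coset_Times)
  then show ?thesis
    using P.displacement_eq[of "(a, b)" "(s, t)"] a b assms(3,4)
    by (simp add: lattice_part_Times displacement_eq)
qed

sublocale P: lattice_covariance "\<Lambda> \<times> \<Lambda>" G2 \<pi> "\<Delta> \<times> \<Delta>" "map_prod \<iota> \<iota>" "prod_inner ip"
proof unfold_locales
  have pos: "0 < ip v v" if "v \<noteq> 0" for v using ip that by (simp add: is_inner_product_def)
  have nonneg: "0 \<le> ip v v" for v
    using pos[of v] linear_0[OF linear_ip[of v]] by (cases "v = 0") (auto intro: less_imp_le)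
  have sym: "ip v w = ip w v" for v w using ip by (simp add: is_inner_product_def)
  show "is_inner_product (prod_inner ip)"
    unfolding is_inner_product_def
  proof (intro conjI allI impI)
    show "linear (prod_inner ip v)" for v
      by (rule linearI)
         (simp_all add: prod_inner_def linear_add[OF linear_ip] linear_scale[OF linear_ip] algebra_simps)
    show "linear (\<lambda>v. prod_inner ip v w)" for w
      by (rule linearI)
         (simp_all add: prod_inner_def linear_add[OF linear_ip_left] linear_scale[OF linear_ip_left] algebra_simps)
    show "prod_inner ip v w = prod_inner ip w v" for v w
      unfolding prod_inner_def by (metis sym)
    show "0 < prod_inner ip v v" if "v \<noteq> 0" for v
    proof (cases "fst v = 0")
      case True
      then have "snd v \<noteq> 0" using that by (simp add: prod_eq_iff)
      then show ?thesis unfolding prod_inner_def using pos nonneg by (simp add: add_nonneg_pos)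
    next
      case False
      then show ?thesis unfolding prod_inner_def using pos nonneg by (simp add: add_pos_nonneg)
    qed
  qed
next
  fix v :: "'v \<times> 'v" and C assume "C \<in> V2"
  then obtain A B where AB: "A \<in> V" "B \<in> V" "C = A \<times> B" by (rule V2E)
  have "P.L1 (\<lambda>z. (ip (fst v) (disp A (fst z)))\<^sup>2)" "P.L1 (\<lambda>z. (ip (snd v) (disp B (snd z)))\<^sup>2)"
    using square_integrable_displacement[OF AB(1), of "fst v"]
      square_integrable_displacement[OF AB(2), of "snd v"]
      integrable_map_pmf_eq[of fst \<pi> "\<lambda>s. (ip (fst v) (disp A s))\<^sup>2"]
      integrable_map_pmf_eq[of snd \<pi> "\<lambda>s. (ip (snd v) (disp B s))\<^sup>2"]
    unfolding map_pmf_fst_pi_rho map_pmf_snd_pi_rho by blast+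
  from square_integrable_pmf_add[OF this, of 1 1]
  show "P.L1 (\<lambda>z. (prod_inner ip v (P.disp C z))\<^sup>2)"
  proof (rule pmf_integrable_cong[THEN iffD1, rotated])
    fix z assume "z \<in> set_pmf \<pi>"
    then have "z \<in> carrier G2" using P.support by blast
    then have "fst z \<in> carrier G" "snd z \<in> carrier G" by (auto simp: DirProd_def)
    then show "(1 * ip (fst v) (disp A (fst z)) + 1 * ip (snd v) (disp B (snd z)))\<^sup>2 =
        (prod_inner ip v (P.disp C z))\<^sup>2"
      using displacement_Times[OF AB(1,2), of "fst z" "snd z"] by (simp add: AB(3) prod_inner_def)
  qed
qed

sublocale Fst: quotient_morphism "\<Lambda> \<times> \<Lambda>" G2 \<pi> \<Lambda> G \<mu> fst
  by unfold_locales
     (use one_closed in \<open>auto simp: hom_def DirProd_def map_pmf_fst_pi_rho\<close>)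

sublocale Snd: quotient_morphism "\<Lambda> \<times> \<Lambda>" G2 \<pi> \<Lambda> G \<mu> snd
  by unfold_locales
     (use one_closed in \<open>auto simp: hom_def DirProd_def map_pmf_snd_pi_rho\<close>)

end

section \<open>The covariance of the coupled walk\<close>

context diagonal_coupling
begin

lemma edges_TimesE:
  assumes "e \<in> edges G2 (\<Lambda> \<times> \<Lambda>) \<pi>"
  obtains A B s t where "e = (A \<times> B, (s, t))" "A \<in> V" "B \<in> V" "s \<in> carrier G" "t \<in> carrier G"
    "fst ` (A \<times> B) = A" "snd ` (A \<times> B) = B"
proof -
  have e: "fst e \<in> V2" "snd e \<in> carrier G2"
    using assms P.steps_carrier unfolding edges_def by auto
  obtain A B where AB: "A \<in> V" "B \<in> V" "fst e = A \<times> B" using V2E[OF e(1)] .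
  obtain s t where st: "snd e = (s, t)" by (cases "snd e")
  show ?thesis
  proof (rule that)
    show "e = (A \<times> B, (s, t))" using AB(3) st by (simp add: prod_eq_iff)
    show "s \<in> carrier G" "t \<in> carrier G" using e(2) st by simp_all
    show "fst ` (A \<times> B) = A" "snd ` (A \<times> B) = B"
      using vertex_nonempty[OF AB(1)] vertex_nonempty[OF AB(2)] by auto
  qed (rule AB)+
qed

text \<open>Displacements in the product are componentwise, and pairing with \<open>(v, 0)\<close>
  in the product inner product reads off the first component.\<close>

lemma hat_fst: "P.hat_form (v, 0) = Fst.pullback (hat_form v)"
proof (rule ext)
  fix e
  show "P.hat_form (v, 0) e = Fst.pullback (hat_form v) e"
  proof (cases "e \<in> edges G2 (\<Lambda> \<times> \<Lambda>) \<pi>")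
    case True
    then obtain A B s t where e: "e = (A \<times> B, (s, t))" "A \<in> V" "B \<in> V" "s \<in> carrier G" "t \<in> carrier G"
      "fst ` (A \<times> B) = A" by (rule edges_TimesE)
    have "(A, s) \<in> edges G \<Lambda> \<mu>" using Fst.image_edge[OF True] by (simp only: e(1,6) fst_conv snd_conv)
    then show ?thesis
      using True e
      by (simp add: P.hat_eq Fst.pullback_eq hat_eq displacement_Times prod_inner_def
          linear_0[OF linear_ip_left])
  qed (simp add: hat_def Fst.pullback_def)
qed

lemma hat_snd: "P.hat_form (0, v) = Snd.pullback (hat_form v)"
proof (rule ext)
  fix e
  show "P.hat_form (0, v) e = Snd.pullback (hat_form v) e"
  proof (cases "e \<in> edges G2 (\<Lambda> \<times> \<Lambda>) \<pi>")
    case True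
    then obtain A B s t where e: "e = (A \<times> B, (s, t))" "A \<in> V" "B \<in> V" "s \<in> carrier G" "t \<in> carrier G"
      "snd ` (A \<times> B) = B" by (rule edges_TimesE)
    have "(B, t) \<in> edges G \<Lambda> \<mu>" using Snd.image_edge[OF True] by (simp only: e(1,6) fst_conv snd_conv)
    then show ?thesis
      using True e
      by (simp add: P.hat_eq Snd.pullback_eq hat_eq displacement_Times prod_inner_def
          linear_0[OF linear_ip_left])
  qed (simp add: hat_def Snd.pullback_def)
qed

lemma hpart_fst: "P.hpart (v, 0) = Fst.pullback (hpart v)"
  unfolding hat_fst by (rule P.harmonic_part_eqI[OF Fst.is_harmonic_part_pullback[OF is_harmonic_part_harm]])

lemma hpart_snd: "P.hpart (0, v) = Snd.pullback (hpart v)"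
  unfolding hat_snd by (rule P.harmonic_part_eqI[OF Snd.is_harmonic_part_pullback[OF is_harmonic_part_harm]])

lemma P_N: "P.N = N * N"
  by (simp add: card_V2)

lemma pullback_Times:
  assumes "A \<in> V" "B \<in> V" "z \<in> set_pmf \<pi>"
  shows "Fst.pullback \<omega> (A \<times> B, z) = \<omega> (A, fst z)"
    and "Snd.pullback \<omega> (A \<times> B, z) = \<omega> (B, snd z)"
proof -
  have "A \<times> B \<in> V2" using assms unfolding vertices_Times by blast
  moreover have "fst ` (A \<times> B) = A" "snd ` (A \<times> B) = B"
    using vertex_nonempty[OF assms(1)] vertex_nonempty[OF assms(2)] by auto
  ultimately show "Fst.pullback \<omega> (A \<times> B, z) = \<omega> (A, fst z)"
    and "Snd.pullback \<omega> (A \<times> B, z) = \<omega> (B, snd z)"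
    using Fst.pullback_eq[OF Fst.edge_support] Snd.pullback_eq[OF Snd.edge_support] assms(3) by simp_all
qed

lemma chi_pullback:
  assumes \<omega>: "\<omega> \<in> ell2_forms G \<Lambda> \<mu>"
  shows "chi G2 (\<Lambda> \<times> \<Lambda>) \<pi> (Fst.pullback \<omega>) = chi G \<Lambda> \<mu> \<omega>"
    and "chi G2 (\<Lambda> \<times> \<Lambda>) \<pi> (Snd.pullback \<omega>) = chi G \<Lambda> \<mu> \<omega>"
proof -
  have "P.E (\<lambda>z. Fst.pullback \<omega> (A \<times> B, z)) = E (\<lambda>s. \<omega> (A, s))"
    and "P.E (\<lambda>z. Snd.pullback \<omega> (A \<times> B, z)) = E (\<lambda>s. \<omega> (B, s))"
    if "A \<in> V" "B \<in> V" for A B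
  proof -
    have "P.E (\<lambda>z. Fst.pullback \<omega> (A \<times> B, z)) = P.E (\<lambda>z. \<omega> (A, fst z))"
      and "P.E (\<lambda>z. Snd.pullback \<omega> (A \<times> B, z)) = P.E (\<lambda>z. \<omega> (B, snd z))"
      by (rule pmf_expectation_cong, rule pullback_Times[OF that], assumption)+
    then show "P.E (\<lambda>z. Fst.pullback \<omega> (A \<times> B, z)) = E (\<lambda>s. \<omega> (A, s))"
      and "P.E (\<lambda>z. Snd.pullback \<omega> (A \<times> B, z)) = E (\<lambda>s. \<omega> (B, s))"
      using Fst.expectation_comp[of "\<lambda>s. \<omega> (A, s)"] Snd.expectation_comp[of "\<lambda>s. \<omega> (B, s)"]
      by simp_all
  qed
  then show "chi G2 (\<Lambda> \<times> \<Lambda>) \<pi> (Fst.pullback \<omega>) = chi G \<Lambda> \<mu> \<omega>"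
    and "chi G2 (\<Lambda> \<times> \<Lambda>) \<pi> (Snd.pullback \<omega>) = chi G \<Lambda> \<mu> \<omega>"
    unfolding P.chi_eq[OF Fst.pullback_ell2[OF \<omega>]] P.chi_eq[OF Snd.pullback_ell2[OF \<omega>]]
      chi_eq[OF \<omega>] sum_V2 P_N
    using N_pos by (simp_all flip: sum_distrib_left)
qed

text \<open>The expectation at \<open>A \<times> B\<close> does not depend on \<open>B\<close>, so
  summing over \<open>B\<close> gives a factor \<open>N\<close> that cancels one of the two in
  \<open>P.N\<close>.\<close>

lemma covariance_form_fst: "P.cov (v, 0) (w, 0) = cov v w"
proof -
  have "P.E (\<lambda>z. P.hpart (v, 0) (A \<times> B, z) * P.hpart (w, 0) (A \<times> B, z)) =
      E (\<lambda>s. hpart v (A, s) * hpart w (A, s))" if "A \<in> V" "B \<in> V" for A B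
    unfolding hpart_fst Fst.expectation_comp[symmetric]
    by (rule pmf_expectation_cong) (simp only: pullback_Times[OF that])
  then show ?thesis
    unfolding P.covariance_form_eq covariance_form_eq sum_V2 P_N
    unfolding hpart_fst chi_pullback[OF harm_ell2]
    using N_pos by (simp flip: sum_distrib_left)
qed

lemma covariance_form_snd: "P.cov (0, v) (0, w) = cov v w"
proof -
  have "P.E (\<lambda>z. P.hpart (0, v) (A \<times> B, z) * P.hpart (0, w) (A \<times> B, z)) =
      E (\<lambda>s. hpart v (B, s) * hpart w (B, s))" if "A \<in> V" "B \<in> V" for A B
    unfolding hpart_snd Snd.expectation_comp[symmetric]
    by (rule pmf_expectation_cong) (simp only: pullback_Times[OF that])
  then show ?thesis
    unfolding P.covariance_form_eq covariance_form_eq sum_V2 P_N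
    unfolding hpart_snd chi_pullback[OF harm_ell2]
    using N_pos by (simp flip: sum_distrib_left)
qed

text \<open>Averaged over all pairs of cosets, the independent part yields \<open>\<rho>\<close>
  times the product of the two values of \<open>chi\<close>. Subtracting that product once leaves
  \<open>- (1 - \<rho>)\<close> times it, so \<open>1 - \<rho>\<close> factors out of the whole
  expression.\<close>

lemma covariance_form_cross:
  "P.cov (v, 0) (0, w) = (1 - \<rho>) *
     ((\<Sum>A\<in>V. \<Sum>B\<in>V. E (\<lambda>s. hpart v (A, s) * hpart w (B, s))) / (N * N)
      - chi G \<Lambda> \<mu> (hpart v) * chi G \<Lambda> \<mu> (hpart w))"
proof -
  let ?e = "\<lambda>v A. E (\<lambda>s. hpart v (A, s))"
  let ?c = "\<lambda>A B. E (\<lambda>s. hpart v (A, s) * hpart w (B, s))"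
  have "P.E (\<lambda>z. P.hpart (v, 0) (A \<times> B, z) * P.hpart (0, w) (A \<times> B, z)) =
      \<rho> * (?e v A * ?e w B) + (1 - \<rho>) * ?c A B" if AB: "A \<in> V" "B \<in> V" for A B
  proof -
    have "P.E (\<lambda>z. P.hpart (v, 0) (A \<times> B, z) * P.hpart (0, w) (A \<times> B, z)) =
        P.E (\<lambda>z. hpart v (A, fst z) * hpart w (B, snd z))"
      unfolding hpart_fst hpart_snd
      by (rule pmf_expectation_cong) (simp only: pullback_Times[OF AB])
    also have "\<dots> = \<rho> * (?e v A * ?e w B) + (1 - \<rho>) * ?c A B"
      by (intro integrable_pi_rho_mult(2) rho integrable_pmf_mult ell2_integrable
          ell2_square_integrable harm_ell2 AB)
    finally show ?thesis .
  qed
  then have "(\<Sum>A\<in>V. \<Sum>B\<in>V. P.E (\<lambda>z. P.hpart (v, 0) (A \<times> B, z) * P.hpart (0, w) (A \<times> B, z))) =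
      (\<Sum>A\<in>V. \<Sum>B\<in>V. \<rho> * (?e v A * ?e w B) + (1 - \<rho>) * ?c A B)"
    by (intro sum.cong refl)
  also have "\<dots> = \<rho> * ((\<Sum>A\<in>V. ?e v A) * (\<Sum>B\<in>V. ?e w B)) + (1 - \<rho>) * (\<Sum>A\<in>V. \<Sum>B\<in>V. ?c A B)"
    unfolding sum_product by (simp only: sum.distrib sum_distrib_left)
  also have "(\<Sum>A\<in>V. ?e v A) = N * chi G \<Lambda> \<mu> (hpart v)" using N_pos by (simp add: chi_harm)
  also have "(\<Sum>B\<in>V. ?e w B) = N * chi G \<Lambda> \<mu> (hpart w)" using N_pos by (simp add: chi_harm)
  finally have total: "(\<Sum>A\<in>V. \<Sum>B\<in>V. P.E (\<lambda>z. P.hpart (v, 0) (A \<times> B, z) * P.hpart (0, w) (A \<times> B, z))) =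
      \<rho> * (N * chi G \<Lambda> \<mu> (hpart v) * (N * chi G \<Lambda> \<mu> (hpart w))) + (1 - \<rho>) * (\<Sum>A\<in>V. \<Sum>B\<in>V. ?c A B)" .
  show ?thesis
    unfolding P.covariance_form_eq sum_V2 P_N total
    unfolding hpart_fst hpart_snd chi_pullback[OF harm_ell2]
    using N_pos by (simp add: field_simps)
qed

end

section \<open>Semidirect products: the complement as system of representatives\<close>

locale semidirect_coupling =
  diagonal_coupling \<Lambda> G \<mu> \<Delta> \<iota> ip \<rho> + integer_lattice \<Lambda> G \<iota>
  for \<Lambda> and G (structure) and \<mu> and \<Delta> and \<iota> :: "'a \<Rightarrow> real ^ 'm" and ip and \<rho> +
  fixes F :: "'a set"
  assumes semidirect: "semidirect_product G \<Lambda> F"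
    and invariant: "Ad_invariant G \<Lambda> \<iota> ip"
begin

abbreviation "\<theta> \<equiv> normalized_transfer G \<Lambda> \<iota>"

lemma F_subgroup: "subgroup F G" and F_inter: "\<Lambda> \<inter> F = {\<one>}" and F_generates: "\<Lambda> <#> F = carrier G"
  using semidirect by (simp_all add: semidirect_product_def)

lemma F_carrier: "f \<in> F \<Longrightarrow> f \<in> carrier G"
  by (rule subgroup.mem_carrier[OF F_subgroup])

lemma F_representatives: "representatives G \<Lambda> F"
  unfolding representatives_def
proof (intro conjI ballI)
  show "F \<subseteq> carrier G" using F_carrier by blast
  show "\<one> \<in> F" by (rule subgroup.one_closed[OF F_subgroup])
  fix \<gamma> assume \<gamma>: "\<gamma> \<in> carrier G"
  then obtain l f where lf: "l \<in> \<Lambda>" "f \<in> F" "\<gamma> = l \<otimes> f"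
    unfolding F_generates[symmetric] set_mult_def by blast
  show "\<exists>!x. x \<in> F \<and> \<gamma> \<in> \<Lambda> #> x"
  proof (rule ex1I[of _ f])
    show "f \<in> F \<and> \<gamma> \<in> \<Lambda> #> f"
      using lf F_carrier rcosI[OF lf(1) subset] by blast
    fix x assume x: "x \<in> F \<and> \<gamma> \<in> \<Lambda> #> x"
    then obtain k where k: "k \<in> \<Lambda>" "\<gamma> = k \<otimes> x" unfolding r_coset_def by blast
    have car: "x \<in> carrier G" "f \<in> carrier G" "l \<in> carrier G" "k \<in> carrier G"
      using x lf k F_carrier mem_carrier by blast+
    have "l \<otimes> f = k \<otimes> x" using lf(3) k(2) by simp
    then have "inv k \<otimes> (l \<otimes> f) \<otimes> inv f = inv k \<otimes> (k \<otimes> x) \<otimes> inv f" by simp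
    moreover have "inv k \<otimes> (l \<otimes> f) \<otimes> inv f = inv k \<otimes> l" using car by (simp add: m_assoc)
    moreover have "inv k \<otimes> (k \<otimes> x) = x" using car m_assoc[of "inv k" k x, symmetric] by simp
    ultimately have eq: "inv k \<otimes> l = x \<otimes> inv f" by simp
    have "inv k \<otimes> l \<in> \<Lambda>" using k(1) lf(1) by simp
    moreover have "x \<otimes> inv f \<in> F"
      using x lf(2) subgroup.m_closed[OF F_subgroup] subgroup.m_inv_closed[OF F_subgroup] by blast
    ultimately have "x \<otimes> inv f \<in> \<Lambda> \<inter> F" unfolding eq by blast
    then have "x \<otimes> inv f = \<one>" unfolding F_inter by blast
    then show "x = f" using car by (metis inv_closed inv_inv inv_equality)
  qed
qed

text \<open>A second copy of the displacement theory on the same graph; \<open>Split.\<Phi>\<close>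
  is the \<Lambda>-component in the semidirect decomposition, whereas \<open>\<Phi>\<close> still
  refers to \<Delta>.\<close>

sublocale Split: lattice_quotient \<Lambda> G \<mu> F \<iota>
  by unfold_locales (auto simp: \<iota>_mult F_representatives)

lemma one_mem: "\<one> \<in> \<Lambda>"
  by (rule subgroup.one_closed[OF subgroup_axioms])

lemma iota_one: "\<iota> \<one> = 0"
  using iota_mult[OF one_mem one_mem] by simp

text \<open>Starting at the representative \<open>f\<close> and stepping by
  \<open>s = l \<otimes> f'\<close>, one moves the lattice factor to the front: the product is the
  conjugate of \<open>l\<close> by \<open>f\<close> times \<open>f \<otimes> f'\<close>. Since
  \<open>F\<close> is a subgroup, \<open>f \<otimes> f'\<close> is again a representative and leaves
  no lattice remainder; a general system of representatives would leave one.\<close>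

lemma split_displacement:
  assumes A: "A \<in> V" and s: "s \<in> carrier G"
  shows "Split.disp A s = Ad G \<Lambda> \<iota> A (Split.\<Phi> s)"
proof -
  obtain a where a: "a \<in> carrier G" "A = \<Lambda> #> a" using vertexE[OF A] .
  obtain k f where kf: "k \<in> \<Lambda>" "f \<in> F" "a = k \<otimes> f" using Split.carrier_decomp[OF a(1)] .
  obtain l f' where lf: "l \<in> \<Lambda>" "f' \<in> F" "s = l \<otimes> f'" using Split.carrier_decomp[OF s] .
  have car: "f \<in> carrier G" "f' \<in> carrier G" "l \<in> carrier G"
    using kf lf F_carrier mem_carrier by blast+
  have A_f: "A = \<Lambda> #> f"
    using repr_independence[OF rcosI[OF kf(1) subset car(1)] car(1) subgroup_axioms] a(2) kf(3) by simp
  have ff: "f \<otimes> f' \<in> F" by (rule subgroup.m_closed[OF F_subgroup kf(2) lf(2)])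
  have "inv f \<otimes> (f \<otimes> f') = f'" using car m_assoc[of "inv f" f f', symmetric] by simp
  then have "f \<otimes> s = (f \<otimes> l \<otimes> inv f) \<otimes> (f \<otimes> f')"
    using car by (simp add: lf(3) m_assoc)
  then have "Split.\<Phi> (f \<otimes> s) = \<iota> (f \<otimes> l \<otimes> inv f)"
    using Split.lattice_part_eq[OF conj_closed[OF car(1) lf(1)] ff] by simp
  moreover have "Split.\<Phi> f = 0"
    using Split.lattice_part_eq[OF one_mem kf(2)] car(1) by (simp add: iota_one)
  moreover have "Split.\<Phi> s = \<iota> l" unfolding lf(3) by (rule Split.lattice_part_eq[OF lf(1,2)])
  ultimately show ?thesis
    unfolding A_f using Split.displacement_eq[OF car(1) s] Ad_iota[OF car(1) lf(1)] by simp
qed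

text \<open>Both lattice parts shift by the same vector under left multiplication by \<Lambda>, so
  their difference descends to a function \<open>h\<close> on the cosets, and the two displacements
  differ by its increments.\<close>

lemma displacement_cohomologous:
  "\<exists>h. \<forall>A\<in>V. \<forall>s\<in>carrier G. disp A s = Ad G \<Lambda> \<iota> A (Split.\<Phi> s) + (h (A #> s) - h A)"
proof -
  define d where "d \<gamma> = \<Phi> \<gamma> - Split.\<Phi> \<gamma>" for \<gamma>
  have d: "d (l \<otimes> \<gamma>) = d \<gamma>" if "l \<in> \<Lambda>" "\<gamma> \<in> carrier G" for l \<gamma>
    using that by (simp add: d_def lattice_part_mult Split.lattice_part_mult)
  \<comment> \<open>The chosen element is immaterial, since \<open>d\<close> is constant on each
    coset.\<close>
  define h where "h A = d (SOME \<gamma>. \<gamma> \<in> A)" for A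
  have h: "h (\<Lambda> #> \<gamma>) = d \<gamma>" if \<gamma>: "\<gamma> \<in> carrier G" for \<gamma>
  proof -
    have "(SOME \<gamma>'. \<gamma>' \<in> \<Lambda> #> \<gamma>) \<in> \<Lambda> #> \<gamma>"
      by (rule someI[of _ \<gamma>]) (rule rcos_self[OF \<gamma> subgroup_axioms])
    then obtain l where "l \<in> \<Lambda>" "(SOME \<gamma>'. \<gamma>' \<in> \<Lambda> #> \<gamma>) = l \<otimes> \<gamma>" unfolding r_coset_def by blast
    then show ?thesis using d[OF _ \<gamma>] by (simp add: h_def)
  qed
  have "disp A s = Ad G \<Lambda> \<iota> A (Split.\<Phi> s) + (h (A #> s) - h A)"
    if A: "A \<in> V" and s: "s \<in> carrier G" for A s
  proof -
    obtain a where a: "a \<in> carrier G" "A = \<Lambda> #> a" using vertexE[OF A] .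
    have "disp A s = Split.disp A s + (h (A #> s) - h A)"
      using a s by (simp add: displacement_eq Split.displacement_eq coset_mult_assoc[OF subset] h d_def)
    then show ?thesis by (simp only: split_displacement[OF A s])
  qed
  then show ?thesis by blast
qed

text \<open>Vectors in the range of \<theta> are fixed by the action, so \<open>Ad\<close> may be
  inserted in the other slot as well and then removed by invariance of the inner product.\<close>

lemma ip_Ad_range:
  assumes v: "v \<in> range \<theta>" and A: "A \<in> V"
  shows "ip v (Ad G \<Lambda> \<iota> A x) = ip v x"
proof -
  have "Ad G \<Lambda> \<iota> A v = v" using v Ad_normalized_transfer[OF A finite_rcosets] by auto
  moreover have "ip (Ad G \<Lambda> \<iota> A v) (Ad G \<Lambda> \<iota> A x) = ip v x"
    using invariant A unfolding Ad_invariant_def by blast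
  ultimately show ?thesis by simp
qed

text \<open>Once the exact form coming from \<open>h\<close> is subtracted, what remains depends on
  the step alone. Its vertex means are therefore equal, so it is harmonic already and uniqueness
  identifies it.\<close>

lemma hpart_range:
  assumes v: "v \<in> range \<theta>" and As: "(A, s) \<in> edges G \<Lambda> \<mu>"
  shows "hpart v (A, s) = ip v (Split.\<Phi> s)"
proof -
  obtain h where h: "\<forall>A\<in>V. \<forall>s\<in>carrier G. disp A s = Ad G \<Lambda> \<iota> A (Split.\<Phi> s) + (h (A #> s) - h A)"
    using displacement_cohomologous by blast
  let ?f = "\<lambda>A. ip v (h A)"
  define u where "u = (\<lambda>e\<in>edges G \<Lambda> \<mu>. 1 * hat_form v e + (-1) * differential G \<Lambda> \<mu> ?f e)"
  have u_eq: "u (A, s) = ip v (Split.\<Phi> s)" if e: "(A, s) \<in> edges G \<Lambda> \<mu>" for A s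
  proof -
    have A: "A \<in> V" and s: "s \<in> carrier G" using e steps_carrier unfolding mem_edges by blast+
    have "hat_form v (A, s) = ip v (Ad G \<Lambda> \<iota> A (Split.\<Phi> s) + (h (A #> s) - h A))"
      unfolding hat_eq[OF e] using h A s by simp
    also have "\<dots> = ip v (Split.\<Phi> s) + (ip v (h (A #> s)) - ip v (h A))"
      by (simp only: linear_add[OF linear_ip] linear_diff[OF linear_ip] ip_Ad_range[OF v A])
    finally show ?thesis
      using e by (simp add: u_def differential_def edge_end_def edge_start_def)
  qed
  have u: "u \<in> ell2_forms G \<Lambda> \<mu>"
    unfolding u_def by (intro ell2_linear hat_ell2 differential_ell2)
  have "E (\<lambda>s. u (A, s)) = E (\<lambda>s. ip v (Split.\<Phi> s))" if "A \<in> V" for A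
    by (rule pmf_expectation_cong, rule u_eq) (use that in \<open>simp add: mem_edges\<close>)
  then have "harmonic G \<Lambda> \<mu> u" by (rule harmonicI[OF u])
  moreover have "\<forall>e\<in>edges G \<Lambda> \<mu>. hat_form v e = u e + differential G \<Lambda> \<mu> ?f e"
    by (simp add: u_def)
  ultimately have "is_harmonic_part (hat_form v) u"
    unfolding is_harmonic_part_def using u by blast
  then have "hpart v = u" by (rule harmonic_part_eqI)
  then show ?thesis using u_eq[OF As] by simp
qed

text \<open>Up to increments of functions along \<open>A\<close> to \<open>A #> s\<close>, the
  harmonic part is the pairing of \<open>v\<close> with the action of \<open>A\<close> on
  \<open>Split.\<Phi> s\<close>. The increments cancel in the sum because the step permutes the
  cosets, and the rest adds up to \<open>N\<close> times the pairing of \<open>v\<close> with a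
  value of \<theta>.\<close>

lemma sum_hpart_orth_compl:
  assumes v: "v \<in> orth_compl ip (range \<theta>)" and s: "s \<in> set_pmf \<mu>"
  shows "(\<Sum>A\<in>V. hpart v (A, s)) = 0"
proof -
  have sc: "s \<in> carrier G" using s support by blast
  have e: "(A, s) \<in> edges G \<Lambda> \<mu>" if "A \<in> V" for A using that s by (simp add: mem_edges)
  obtain h where h: "\<forall>A\<in>V. \<forall>s\<in>carrier G. disp A s = Ad G \<Lambda> \<iota> A (Split.\<Phi> s) + (h (A #> s) - h A)"
    using displacement_cohomologous by blast
  obtain f where f: "\<forall>e\<in>edges G \<Lambda> \<mu>. hat_form v e = hpart v e + differential G \<Lambda> \<mu> f e"
    using is_harmonic_part_harm[of v] unfolding is_harmonic_part_def by blast
  have "hpart v (A, s) = ip v (Ad G \<Lambda> \<iota> A (Split.\<Phi> s))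
      + (ip v (h (A #> s)) - ip v (h A)) - (f (A #> s) - f A)" if A: "A \<in> V" for A
  proof -
    have "ip v (disp A s) = ip v (Ad G \<Lambda> \<iota> A (Split.\<Phi> s)) + (ip v (h (A #> s)) - ip v (h A))"
      using h[rule_format, OF A sc] by (simp only: linear_add[OF linear_ip] linear_diff[OF linear_ip])
    then show ?thesis
      using f[rule_format, OF e[OF A]] hat_eq[OF e[OF A], of v] e[OF A]
      by (simp add: differential_def edge_end_def edge_start_def)
  qed
  then have "(\<Sum>A\<in>V. hpart v (A, s)) = (\<Sum>A\<in>V. ip v (Ad G \<Lambda> \<iota> A (Split.\<Phi> s))
      + (ip v (h (A #> s)) - ip v (h A)) - (f (A #> s) - f A))"
    by (rule sum.cong[OF refl])
  also have "\<dots> = (\<Sum>A\<in>V. ip v (Ad G \<Lambda> \<iota> A (Split.\<Phi> s)))"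
    using sum_coset_step[OF sc, of f] sum_coset_step[OF sc, of "\<lambda>A. ip v (h A)"]
    by (simp add: sum.distrib sum_subtractf)
  also have "\<dots> = ip v (\<Sum>A\<in>V. Ad G \<Lambda> \<iota> A (Split.\<Phi> s))"
    by (rule linear_sum[OF linear_ip, symmetric])
  also have "(\<Sum>A\<in>V. Ad G \<Lambda> \<iota> A (Split.\<Phi> s)) = N *\<^sub>R \<theta> (Split.\<Phi> s)"
    using N_pos by (simp add: normalized_transfer_def)
  also have "ip v (N *\<^sub>R \<theta> (Split.\<Phi> s)) = 0"
    using v by (simp add: linear_scale[OF linear_ip] orth_compl_def)
  finally show ?thesis .
qed

text \<open>All pairs of cosets contribute the same number \<open>k\<close>, so the average over
  pairs in the cross term equals the average over single cosets in \<open>cov v w\<close>.\<close>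

lemma covariance_form_cross_range:
  assumes v: "v \<in> range \<theta>" and w: "w \<in> range \<theta>"
  shows "P.cov (v, 0) (0, w) = (1 - \<rho>) * cov v w"
proof -
  define k where "k = E (\<lambda>s. ip v (Split.\<Phi> s) * ip w (Split.\<Phi> s))"
  have "E (\<lambda>s. hpart v (A, s) * hpart w (B, s)) = k" if AB: "A \<in> V" "B \<in> V" for A B
    unfolding k_def
  proof (rule pmf_expectation_cong)
    fix s assume "s \<in> set_pmf \<mu>"
    then have "(A, s) \<in> edges G \<Lambda> \<mu>" "(B, s) \<in> edges G \<Lambda> \<mu>" using AB by (simp_all add: mem_edges)
    then show "hpart v (A, s) * hpart w (B, s) = ip v (Split.\<Phi> s) * ip w (Split.\<Phi> s)"
      by (simp only: hpart_range[OF v] hpart_range[OF w])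
  qed
  then show ?thesis
    unfolding covariance_form_cross covariance_form_eq using N_pos by simp
qed

text \<open>For a fixed step the double sum over cosets factors into two coset sums, and one of them
  vanishes. The same vanishing, integrated over the step, kills the corresponding
  \<open>chi\<close>.\<close>

lemma covariance_form_cross_orth_compl:
  assumes "v \<in> orth_compl ip (range \<theta>) \<or> w \<in> orth_compl ip (range \<theta>)"
  shows "P.cov (v, 0) (0, w) = 0"
proof -
  have chi0: "chi G \<Lambda> \<mu> (hpart x) = 0" if x: "x \<in> orth_compl ip (range \<theta>)" for x
  proof -
    have "(\<Sum>A\<in>V. E (\<lambda>s. hpart x (A, s))) = E (\<lambda>s. \<Sum>A\<in>V. hpart x (A, s))"
      by (rule Bochner_Integration.integral_sum[symmetric]) (rule ell2_integrable[OF harm_ell2])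
    also have "\<dots> = E (\<lambda>s. 0)"
      by (rule pmf_expectation_cong) (rule sum_hpart_orth_compl[OF x])
    finally show ?thesis by (simp add: chi_harm)
  qed
  have int: "L1 (\<lambda>s. hpart v (A, s) * hpart w (B, s))" if "A \<in> V" "B \<in> V" for A B
    by (intro integrable_pmf_mult ell2_square_integrable harm_ell2 that)
  have "(\<Sum>A\<in>V. \<Sum>B\<in>V. E (\<lambda>s. hpart v (A, s) * hpart w (B, s))) =
      E (\<lambda>s. \<Sum>A\<in>V. \<Sum>B\<in>V. hpart v (A, s) * hpart w (B, s))"
  proof -
    have "(\<Sum>A\<in>V. \<Sum>B\<in>V. E (\<lambda>s. hpart v (A, s) * hpart w (B, s))) =
        (\<Sum>A\<in>V. E (\<lambda>s. \<Sum>B\<in>V. hpart v (A, s) * hpart w (B, s)))"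
      by (intro sum.cong refl Bochner_Integration.integral_sum[symmetric] int)
    also have "\<dots> = E (\<lambda>s. \<Sum>A\<in>V. \<Sum>B\<in>V. hpart v (A, s) * hpart w (B, s))"
      by (intro Bochner_Integration.integral_sum[symmetric] Bochner_Integration.integrable_sum int)
    finally show ?thesis .
  qed
  also have "\<dots> = E (\<lambda>s. 0)"
  proof (rule pmf_expectation_cong)
    fix s assume s: "s \<in> set_pmf \<mu>"
    have "(\<Sum>A\<in>V. \<Sum>B\<in>V. hpart v (A, s) * hpart w (B, s)) =
        (\<Sum>A\<in>V. hpart v (A, s)) * (\<Sum>B\<in>V. hpart w (B, s))"
      by (rule sum_product[symmetric])
    also have "\<dots> = 0" using assms sum_hpart_orth_compl[OF _ s] by auto
    finally show "(\<Sum>A\<in>V. \<Sum>B\<in>V. hpart v (A, s) * hpart w (B, s)) = 0" .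
  qed
  finally have "(\<Sum>A\<in>V. \<Sum>B\<in>V. E (\<lambda>s. hpart v (A, s) * hpart w (B, s))) = 0" by simp
  then show ?thesis
    unfolding covariance_form_cross using assms chi0 by auto
qed

end

theorem proposition5p7:
  fixes \<Gamma> :: "('g, 'r) monoid_scheme"
    and \<Lambda> F \<Delta> :: "'g set"
    and \<iota> :: "'g \<Rightarrow> real ^ 'm"
    and ip :: "real ^ 'm \<Rightarrow> real ^ 'm \<Rightarrow> real"
    and \<mu> :: "'g pmf"
    and \<rho> :: real
  assumes semidirect: "semidirect_product \<Gamma> \<Lambda> F" "finite F"
    and lattice: "identifies_with_Zm \<Gamma> \<Lambda> \<iota>"
    and inner: "is_inner_product ip" "Ad_invariant \<Gamma> \<Lambda> \<iota> ip"
    and reps: "representatives \<Gamma> \<Lambda> \<Delta>"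
    and mu: "set_pmf \<mu> \<subseteq> carrier \<Gamma>" "finite_second_moment \<Gamma> \<mu>"
      "semigroup_generated \<Gamma> (set_pmf \<mu>) = carrier \<Gamma>"
    and rho: "0 \<le> \<rho>" "\<rho> \<le> 1"
    and pirho: "aperiodic (\<Gamma> \<times>\<times> \<Gamma>) (pi_rho \<rho> \<mu>)"
      "semigroup_generated (\<Gamma> \<times>\<times> \<Gamma>) (set_pmf (pi_rho \<rho> \<mu>)) = carrier (\<Gamma> \<times>\<times> \<Gamma>)"
  defines "\<Sigma>\<mu> \<equiv> covariance \<Gamma> \<Lambda> \<Delta> \<iota> ip \<mu>"
    and "\<Sigma>\<pi> \<equiv> covariance (\<Gamma> \<times>\<times> \<Gamma>) (\<Lambda> \<times> \<Lambda>) (\<Delta> \<times> \<Delta>) (map_prod \<iota> \<iota>) (prod_inner ip)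
                  (pi_rho \<rho> \<mu>)"
    and "I \<equiv> range (normalized_transfer \<Gamma> \<Lambda> \<iota>)"
  shows "(\<forall>v w. prod_inner ip (v, 0) (\<Sigma>\<pi> (w, 0)) = ip v (\<Sigma>\<mu> w) \<and>
                prod_inner ip (0, v) (\<Sigma>\<pi> (0, w)) = ip v (\<Sigma>\<mu> w)) \<and>
         (\<forall>v\<in>I. \<forall>w\<in>I. prod_inner ip (v, 0) (\<Sigma>\<pi> (0, w)) = (1 - \<rho>) * ip v (\<Sigma>\<mu> w)) \<and>
         (\<forall>v w. v \<in> orth_compl ip I \<or> w \<in> orth_compl ip I \<longrightarrow>
                prod_inner ip (v, 0) (\<Sigma>\<pi> (0, w)) = 0)"
proof -
  have normal: "\<Lambda> \<lhd> \<Gamma>" and subgroup_F: "subgroup F \<Gamma>" and generates: "\<Lambda> <#>\<^bsub>\<Gamma>\<^esub> F = carrier \<Gamma>"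
    using semidirect(1) by (simp_all add: semidirect_product_def)
  interpret normal \<Lambda> \<Gamma> by (rule normal)
  \<comment> \<open>Each coset has a representative in the finite group \<open>F\<close>, so the
    quotient graph has finitely many vertices.\<close>
  have "rcosets\<^bsub>\<Gamma>\<^esub> \<Lambda> \<subseteq> (\<lambda>f. \<Lambda> #>\<^bsub>\<Gamma>\<^esub> f) ` F"
  proof
    fix C assume "C \<in> rcosets\<^bsub>\<Gamma>\<^esub> \<Lambda>"
    then obtain x where x: "x \<in> carrier \<Gamma>" "C = \<Lambda> #>\<^bsub>\<Gamma>\<^esub> x" by (auto simp: RCOSETS_def)
    obtain l f where lf: "l \<in> \<Lambda>" "f \<in> F" "x = l \<otimes>\<^bsub>\<Gamma>\<^esub> f"
      using x(1) unfolding generates[symmetric] set_mult_def by blast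
    have f: "f \<in> carrier \<Gamma>" by (rule subgroup.mem_carrier[OF subgroup_F lf(2)])
    have "C = \<Lambda> #>\<^bsub>\<Gamma>\<^esub> f"
      using repr_independence[OF rcosI[OF lf(1) subset f] f subgroup_axioms] x(2) lf(3) by simp
    then show "C \<in> (\<lambda>f. \<Lambda> #>\<^bsub>\<Gamma>\<^esub> f) ` F" using lf(2) by blast
  qed
  then have finite: "finite (rcosets\<^bsub>\<Gamma>\<^esub> \<Lambda>)" using semidirect(2) finite_subset by blast
  \<comment> \<open>The interpretation proceeds in two stages: the lemma that turns the second
    moment into square integrability lives in \<open>lattice_quotient\<close>, and its conclusion is
    an assumption of the next locale.\<close>
  interpret lattice_quotient \<Lambda> \<Gamma> \<mu> \<Delta> \<iota>
    using finite mu(1,3) reps lattice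
    by unfold_locales (simp_all add: identifies_with_Zm_def)
  have lin: "linear (ip v)" for v using inner(1) by (simp add: is_inner_product_def)
  interpret semidirect_coupling \<Lambda> \<Gamma> \<mu> \<Delta> \<iota> ip \<rho> F
    by unfold_locales
       (rule inner square_integrable_if_finite_second_moment[OF lin mu(2)] rho pirho(2) lattice
         semidirect(1) | assumption)+
  have cov_mu: "ip v (\<Sigma>\<mu> w) = cov v w" for v w
    unfolding \<Sigma>\<mu>_def by (rule covariance_spec)
  have cov_pi: "prod_inner ip v (\<Sigma>\<pi> w) = P.cov v w" for v w
    unfolding \<Sigma>\<pi>_def by (rule P.covariance_spec)
  show ?thesis
    unfolding cov_mu cov_pi I_def covariance_form_fst covariance_form_snd
    using covariance_form_cross_range covariance_form_cross_orth_compl by blast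
qed

end
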